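(* For every encoder--decoder transformer $T$ over a floating-point format $\mathcal F(p,q)$ and token set $\Sigma$, without a final $\mathrm{softmax}$, with output dimension $d_{\text{out}}$, one can construct a $\mathrm{CPG}$-automaton $A$ over $\Sigma$ equivalent to $T$: for every $\Sigma$-labelled two-sorted graph $\mathcal G$ and every vertex $v$ in the suffix of $\mathcal G$, the output of $A$ at $(\mathcal G,v)$ equals the bit-wise interpretation of the output vector of $T$ at $v$.
   Context: Floating-point numbers: for $p,q\in\mathbb{Z}_+$ a float over $p,q$ is a bit string $b_0b_1\cdots b_{q+p}$; $b_0$ is the sign, $b_1\cdots b_q$ the exponent (value $e$), $b_{q+1}\cdots b_{q+p}$ the significand (value $s$). With $a=2^{p-1}$, $b=2^{q-1}-1$ it represents $(-1)^{b_0}\frac{s}{a}2^{e-b}$, except that significand $0^p$ with exponent $1^q$ represents $\pm\infty$ according to the sign. The format $\mathcal F(p,q)$ consists of normalised ($b_{q+1}=1$) and subnormalised ($b_{q+1}=0$, exponent $0^q$) floats together with $\infty,-\infty,\mathrm{NaN}$. Operations $+,-,\cdot,\div,\sqrt{\ }$ compute the exact result and round to the nearest element of the format (overflow to $\pm\infty$, NaN for undefined operations or NaN inputs); $\exp$ is implemented by an approximation inside the format. A sum of a multiset of floats is always computed by adding the floats in increasing order. Two-sorted graphs: $\mathrm{BOS}\notin\Sigma$. A $\Sigma$-labelled two-sorted graph is $\mathcal{G}=(V,E,\lambda)$ with $V=[n]$, $E=\{(i,i+1)\}$, $\lambda:V\to\Sigma\cup\{\mathrm{BOS}\}$, exactly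 one vertex $w$ labelled $\mathrm{BOS}$; prefix $\mathcal G_p$ = vertices $1,\dots,w-1$, suffix $\mathcal G_s$ = vertices $w,\dots,n$. Encoder--decoder transformer over $\mathcal F$ with dimensions $(d,d_k,d_v,d_{ff},d_{\text{out}})$ (all computations in $\mathcal F$): embedding $\mathrm{em}:\Sigma\cup\{\mathrm{BOS}\}\to\mathcal F^d$ applied vertex-wise to $\mathcal G_p$ and $\mathcal G_s$. Strict causal mask sets entry $(i,j)$ to $-\infty$ when $j\ge i$. $\mathrm{softmax}(\mathbf x)_i=e^{x_i-\beta}/\sum_j e^{x_j-\beta}$, $\beta=\max_j x_j$, with $\mathrm{softmax}(-\infty,\dots,-\infty)=(0,\dots,0)$. Attention head ($W^Q,W^K\in\mathcal F^{d\times d_k}$, $W^V\in\mathcal F^{d\times d_v}$): $(X,Y)\mapsto\mathrm{softmax}((YW^Q)(XW^K)^\top/\sqrt{d_k})(XW^V)$, softmax row-wise; masked heads apply the mask before softmax. Multi-head layer: $\mathrm{concat}(H^{(1)},\dots,H^{(h)})W^O$, $W^O\in\mathcal F^{hd_v\times d}$; self-attention has $X=Y$, cross-attention is unmasked. MLP: $M(\mathbf x)=\mathrm{ReLU}(\mathbf xW_1+b_1)W_2+b_2$ row-wise. Encoder layer $\mathsf{EL}(X)=M(X')+X'$, $X'=\mathsf{MHSA}(X)+X$ (unmasked). Decoder layer $\mathsf{DL}(X,Y)=M(Y'')+Y''$, $Y''=\mathsf{MHCA}(X,Y')+Y'$, $Y'=\mathsf{MHSA}_{\mathrm{mask}}(Y)+Y$.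 Encoder $\mathsf E$ = composition of $L_1$ encoder layers; decoder $\mathsf D(X,Y)=\mathsf{DL}_{L_2}(X,\dots\mathsf{DL}_1(X,Y)\dots)$. Output head $\mathrm{Out}(Y)=YW^{\mathrm{out}}+b^{\mathrm{out}}$. $T(\mathcal G)=\mathrm{Out}(\mathsf D(\mathsf E(\mathrm{em}(\mathcal G_p)),\mathrm{em}(\mathcal G_s)))$; the row of suffix vertex $v$ is the output of $T$ at $v$. Bit-wise interpretation of $(f_1,\dots,f_{d_{\text{out}}})\in\mathcal F^{d_{\text{out}}}$: the concatenation of the bit strings of $f_1,\dots,f_{d_{\text{out}}}$ (length $d_{\text{out}}(p+q+1)$). $\mathrm{CPG}$-automaton over $\Sigma$: a tuple $(Q,\pi,\delta,n,b)$ with finite nonempty $Q\subseteq\{0,1\}^m$, $\pi:\Sigma\cup\{\mathrm{BOS}\}\to Q$, $\delta:Q\times\mathcal M_k(Q)\times\mathcal M_k(Q)\to Q$ for some $k\in\mathbb N$ where $\mathcal M_k(Q)$ are multisets over $Q$ with multiplicities capped at $k$ ($M_{|k}(x)=\min\{M(x),k\}$), output round $n\in\mathbb N$, output length $b\in\mathbb Z_+$. On a two-sorted graph with $\mathrm{BOS}$ at $w$: $x^0_v=\pi(\lambda(v))$ and $x^{t+1}_v=\delta(x^t_v,\{\{x^t_u\mid u<w\}\}_{|k},\{\{x^t_u\mid w\le u<v\}\}_{|k})$. The output at $(\mathcal G,v)$ is the length-$b$ prefix of $x^n_v$.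
   Formalization: In masked heads the masked positions are left out of the product with XW^V (otherwise 0·∞ or 0·NaN would leak later tokens and the claim fails; for finite entries nothing changes), and the approximation of exp is assumed to satisfy exp(−∞)=0 and exp(NaN)=NaN. *)

theory Defs
  imports
    "HOL-Library.Extended_Real"
    "HOL-Library.Multiset"
    "Jordan_Normal_Form.Matrix"
begin

section \<open>Floating-point formats\<close>

datatype flt = Float "bool list" | NaN

definition bin_val :: "bool list \<Rightarrow> nat" where
  "bin_val bs = horner_sum of_bool 2 (rev bs)"

definition exp_field :: "nat \<Rightarrow> bool list \<Rightarrow> bool list" where
  "exp_field q bs = take q (drop 1 bs)"

definition sig_field :: "nat \<Rightarrow> bool list \<Rightarrow> bool list" where
  "sig_field q bs = drop (q + 1) bs"

definition bias :: "nat \<Rightarrow> int" where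
  "bias q = 2 ^ (q - 1) - 1"

text \<open>The first argument of \<open>inf_bits\<close> is the sign bit.\<close>

definition inf_bits :: "bool \<Rightarrow> nat \<Rightarrow> nat \<Rightarrow> bool list" where
  "inf_bits b p q = b # replicate q True @ replicate p False"

definition normalised :: "nat \<Rightarrow> nat \<Rightarrow> flt set" where
  "normalised p q = {Float bs | bs. length bs = q + p + 1 \<and> bs ! (q + 1)}"

definition subnormalised :: "nat \<Rightarrow> nat \<Rightarrow> flt set" where
  "subnormalised p q = {Float bs | bs. length bs = q + p + 1 \<and> \<not> bs ! (q + 1) \<and>
     exp_field q bs = replicate q False}"

definition format :: "nat \<Rightarrow> nat \<Rightarrow> flt set" where
  "format p q = normalised p q \<union> subnormalised p q \<union>
     {Float (inf_bits False p q), Float (inf_bits True p q), NaN}"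

fun fval :: "nat \<Rightarrow> nat \<Rightarrow> flt \<Rightarrow> ereal option" where
  "fval p q (Float bs) = Some
     (if bs = inf_bits False p q then \<infinity>
      else if bs = inf_bits True p q then -\<infinity>
      else ereal ((-1) ^ of_bool (bs ! 0) * (real (bin_val (sig_field q bs)) / 2 ^ (p - 1)) *
             2 powi (int (bin_val (exp_field q bs)) - bias q)))"
| "fval p q NaN = None"

section \<open>Floating-point arithmetic\<close>

text \<open>
  For the purpose of finding the nearest element of the format, an infinity stands at the first
  number beyond the finite range (the power of two following the largest finite float). So an
  exact result overflows once it is half a unit in the last place above the largest finite float.
\<close>

definition round_pos :: "nat \<Rightarrow> nat \<Rightarrow> flt \<Rightarrow> real" where
  "round_pos p q f = (case fval p q f of
       Some (ereal r) \<Rightarrow> r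
     | Some PInfty \<Rightarrow> 2 powi (2 ^ q - bias q)
     | Some MInfty \<Rightarrow> - (2 powi (2 ^ q - bias q))
     | None \<Rightarrow> 0)"

definition nearest_rounding :: "nat \<Rightarrow> nat \<Rightarrow> (real \<Rightarrow> flt) \<Rightarrow> bool" where
  "nearest_rounding p q r \<longleftrightarrow> (\<forall>x. r x \<in> format p q - {NaN} \<and>
     (\<forall>f \<in> format p q - {NaN}. \<bar>x - round_pos p q (r x)\<bar> \<le> \<bar>x - round_pos p q f\<bar>))"

text \<open>
  An arithmetic over the format with parameters \<open>prec\<close> and \<open>expw\<close> fixes what the format leaves open:
  how rounding breaks ties (and which zero it returns), the approximation \<open>fexp\<close> of the exponential
  function, and the bit string that stands for \<open>NaN\<close>.
\<close>

record fp_arith =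
  prec :: nat
  expw :: nat
  rnd :: "real \<Rightarrow> flt"
  fexp :: "flt \<Rightarrow> flt"
  nan_bits :: "bool list"

abbreviation floats :: "fp_arith \<Rightarrow> flt set" where
  "floats A \<equiv> format (prec A) (expw A)"

abbreviation val :: "fp_arith \<Rightarrow> flt \<Rightarrow> ereal option" where
  "val A \<equiv> fval (prec A) (expw A)"

definition finf :: "fp_arith \<Rightarrow> flt" where
  "finf A = Float (inf_bits False (prec A) (expw A))"

definition fminf :: "fp_arith \<Rightarrow> flt" where
  "fminf A = Float (inf_bits True (prec A) (expw A))"

definition fzero :: "fp_arith \<Rightarrow> flt" where
  "fzero A = Float (replicate (expw A + prec A + 1) False)"

definition wf_arith :: "fp_arith \<Rightarrow> bool" where
  "wf_arith A \<longleftrightarrow> prec A > 0 \<and> expw A > 0 \<and>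
     nearest_rounding (prec A) (expw A) (rnd A) \<and>
     fexp A ` floats A \<subseteq> floats A \<and> fexp A NaN = NaN \<and> val A (fexp A (fminf A)) = Some 0 \<and>
     length (nan_bits A) = expw A + prec A + 1"

definition fround :: "fp_arith \<Rightarrow> ereal option \<Rightarrow> flt" where
  "fround A r = (case r of
       None \<Rightarrow> NaN
     | Some PInfty \<Rightarrow> finf A
     | Some MInfty \<Rightarrow> fminf A
     | Some (ereal x) \<Rightarrow> rnd A x)"

text \<open>Exact results on the extended reals; \<open>None\<close> marks an undefined operation.\<close>

definition exact_add :: "ereal \<Rightarrow> ereal \<Rightarrow> ereal option" where
  "exact_add x y = (if \<bar>x\<bar> = \<infinity> \<and> y = - x then None else Some (x + y))"

definition exact_mult :: "ereal \<Rightarrow> ereal \<Rightarrow> ereal option" where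
  "exact_mult x y = (if x = 0 \<and> \<bar>y\<bar> = \<infinity> \<or> \<bar>x\<bar> = \<infinity> \<and> y = 0 then None else Some (x * y))"

definition exact_div :: "ereal \<Rightarrow> ereal \<Rightarrow> ereal option" where
  "exact_div x y = (if y = 0 \<or> \<bar>x\<bar> = \<infinity> \<and> \<bar>y\<bar> = \<infinity> then None else Some (x / y))"

definition exact_sqrt :: "ereal \<Rightarrow> ereal option" where
  "exact_sqrt x = (if x < 0 then None else if x = \<infinity> then Some \<infinity>
     else Some (ereal (sqrt (real_of_ereal x))))"

definition lift_op :: "fp_arith \<Rightarrow> (ereal \<Rightarrow> ereal \<Rightarrow> ereal option) \<Rightarrow> flt \<Rightarrow> flt \<Rightarrow> flt" where
  "lift_op A f x y =
     fround A (Option.bind (val A x) (\<lambda>u. Option.bind (val A y) (\<lambda>v. f u v)))"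

definition fadd :: "fp_arith \<Rightarrow> flt \<Rightarrow> flt \<Rightarrow> flt" where
  "fadd A = lift_op A exact_add"

definition fsub :: "fp_arith \<Rightarrow> flt \<Rightarrow> flt \<Rightarrow> flt" where
  "fsub A = lift_op A (\<lambda>x y. exact_add x (- y))"

definition fmult :: "fp_arith \<Rightarrow> flt \<Rightarrow> flt \<Rightarrow> flt" where
  "fmult A = lift_op A exact_mult"

definition fdiv :: "fp_arith \<Rightarrow> flt \<Rightarrow> flt \<Rightarrow> flt" where
  "fdiv A = lift_op A exact_div"

definition fsqrt :: "fp_arith \<Rightarrow> flt \<Rightarrow> flt" where
  "fsqrt A x = fround A (Option.bind (val A x) exact_sqrt)"

text \<open>
  The place of \<open>NaN\<close> in the order is irrelevant: a sum with a \<open>NaN\<close> summand is \<open>NaN\<close>, and so is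
  the maximum below.
\<close>

definition fkey :: "fp_arith \<Rightarrow> flt \<Rightarrow> ereal" where
  "fkey A x = (case val A x of Some r \<Rightarrow> r | None \<Rightarrow> \<infinity>)"

definition fsum :: "fp_arith \<Rightarrow> flt list \<Rightarrow> flt" where
  "fsum A xs = foldl (fadd A) (fzero A) (sort_key (fkey A) xs)"

definition fmax :: "fp_arith \<Rightarrow> flt list \<Rightarrow> flt" where
  "fmax A xs = (if NaN \<in> set xs then NaN else arg_max_on (fkey A) (set xs))"

definition frelu :: "fp_arith \<Rightarrow> flt \<Rightarrow> flt" where
  "frelu A x = (case val A x of None \<Rightarrow> NaN | Some r \<Rightarrow> if r > 0 then x else fzero A)"

fun flt_bits :: "fp_arith \<Rightarrow> flt \<Rightarrow> bool list" where
  "flt_bits A (Float bs) = bs"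
| "flt_bits A NaN = nan_bits A"

definition bitwise :: "fp_arith \<Rightarrow> flt vec \<Rightarrow> bool list" where
  "bitwise A y = concat (map (flt_bits A) (list_of_vec y))"

section \<open>Matrices over a format\<close>

definition flt_vecs :: "fp_arith \<Rightarrow> nat \<Rightarrow> flt vec set" where
  "flt_vecs A n = {x \<in> carrier_vec n. \<forall>i<n. x $ i \<in> floats A}"

definition flt_mats :: "fp_arith \<Rightarrow> nat \<Rightarrow> nat \<Rightarrow> flt mat set" where
  "flt_mats A m n = {X \<in> carrier_mat m n. \<forall>i<m. \<forall>j<n. X $$ (i, j) \<in> floats A}"

definition fmat_mult :: "fp_arith \<Rightarrow> flt mat \<Rightarrow> flt mat \<Rightarrow> flt mat" where
  "fmat_mult A X Y = mat (dim_row X) (dim_col Y)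
     (\<lambda>(i, j). fsum A (map (\<lambda>k. fmult A (X $$ (i, k)) (Y $$ (k, j))) [0..<dim_row Y]))"

definition fmat_add :: "fp_arith \<Rightarrow> flt mat \<Rightarrow> flt mat \<Rightarrow> flt mat" where
  "fmat_add A X Y = mat (dim_row X) (dim_col X) (\<lambda>(i, j). fadd A (X $$ (i, j)) (Y $$ (i, j)))"

definition add_bias :: "fp_arith \<Rightarrow> flt mat \<Rightarrow> flt vec \<Rightarrow> flt mat" where
  "add_bias A X b = mat (dim_row X) (dim_col X) (\<lambda>(i, j). fadd A (X $$ (i, j)) (b $ j))"

definition concat_cols :: "nat \<Rightarrow> flt mat list \<Rightarrow> flt mat" where
  "concat_cols n Hs = mat n (\<Sum>H\<leftarrow>Hs. dim_col H)
     (\<lambda>(i, j). concat (map (\<lambda>H. list_of_vec (row H i)) Hs) ! j)"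

section \<open>Attention\<close>

definition softmax :: "fp_arith \<Rightarrow> flt vec \<Rightarrow> flt vec" where
  "softmax A x =
     (if \<forall>i<dim_vec x. x $ i = fminf A then vec (dim_vec x) (\<lambda>_. fzero A)
      else let \<beta> = fmax A (list_of_vec x);
               e = map_vec (\<lambda>y. fexp A (fsub A y \<beta>)) x;
               s = fsum A (list_of_vec e)
           in map_vec (\<lambda>y. fdiv A y s) e)"

definition softmax_rows :: "fp_arith \<Rightarrow> flt mat \<Rightarrow> flt mat" where
  "softmax_rows A S = mat (dim_row S) (dim_col S) (\<lambda>(i, j). softmax A (row S i) $ j)"

definition causal_mask :: "fp_arith \<Rightarrow> flt mat \<Rightarrow> flt mat" where
  "causal_mask A S = mat (dim_row S) (dim_col S)
     (\<lambda>(i, j). if j \<ge> i then fminf A else S $$ (i, j))"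

record head =
  WQ :: "flt mat"
  WK :: "flt mat"
  WV :: "flt mat"

record multi_head =
  heads :: "head list"
  WO :: "flt mat"

definition scores :: "fp_arith \<Rightarrow> head \<Rightarrow> flt mat \<Rightarrow> flt mat \<Rightarrow> flt mat" where
  "scores A H X Y =
     map_mat (\<lambda>s. fdiv A s (fsqrt A (fround A (Some (ereal (real (dim_col (WQ H))))))))
       (fmat_mult A (fmat_mult A Y (WQ H)) (transpose_mat (fmat_mult A X (WK H))))"

definition attention :: "fp_arith \<Rightarrow> head \<Rightarrow> flt mat \<Rightarrow> flt mat \<Rightarrow> flt mat" where
  "attention A H X Y =
     fmat_mult A (softmax_rows A (scores A H X Y)) (fmat_mult A X (WV H))"

text \<open>
  After softmax a masked position has weight \<open>0\<close> (or \<open>NaN\<close>, if a visible score makes all weights of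
  the row \<open>NaN\<close>), and it is left out of the weighted sum of the rows of \<open>X W\<^sup>V\<close>. Adding it would
  not change the value of the sum when the masked entry of \<open>X W\<^sup>V\<close> is finite (lemma
  \<open>masked_mult_eq\<close>). For an infinite or \<open>NaN\<close> entry the product with the weight \<open>0\<close> would
  be \<open>NaN\<close>, so a row would depend on the positions that the mask hides from it.
\<close>

definition masked_mult :: "fp_arith \<Rightarrow> flt mat \<Rightarrow> flt mat \<Rightarrow> flt mat" where
  "masked_mult A X Y = mat (dim_row X) (dim_col Y)
     (\<lambda>(i, j). fsum A (map (\<lambda>k. fmult A (X $$ (i, k)) (Y $$ (k, j)))
                          (filter (\<lambda>k. k < i) [0..<dim_row Y])))"

definition masked_attention :: "fp_arith \<Rightarrow> head \<Rightarrow> flt mat \<Rightarrow> flt mat \<Rightarrow> flt mat" where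
  "masked_attention A H X Y =
     masked_mult A (softmax_rows A (causal_mask A (scores A H X Y))) (fmat_mult A X (WV H))"

definition mhca :: "fp_arith \<Rightarrow> multi_head \<Rightarrow> flt mat \<Rightarrow> flt mat \<Rightarrow> flt mat" where
  "mhca A N X Y =
     fmat_mult A (concat_cols (dim_row Y) (map (\<lambda>H. attention A H X Y) (heads N))) (WO N)"

definition mhsa :: "fp_arith \<Rightarrow> multi_head \<Rightarrow> flt mat \<Rightarrow> flt mat" where
  "mhsa A N X = mhca A N X X"

definition mhsa_masked :: "fp_arith \<Rightarrow> multi_head \<Rightarrow> flt mat \<Rightarrow> flt mat" where
  "mhsa_masked A N X =
     fmat_mult A (concat_cols (dim_row X) (map (\<lambda>H. masked_attention A H X X) (heads N))) (WO N)"

section \<open>Encoder-decoder transformers\<close>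

record mlp =
  W1 :: "flt mat"
  b1 :: "flt vec"
  W2 :: "flt mat"
  b2 :: "flt vec"

definition mlp_apply :: "fp_arith \<Rightarrow> mlp \<Rightarrow> flt mat \<Rightarrow> flt mat" where
  "mlp_apply A M X =
     add_bias A (fmat_mult A (map_mat (frelu A) (add_bias A (fmat_mult A X (W1 M)) (b1 M))) (W2 M))
       (b2 M)"

record enc_layer =
  enc_self :: multi_head
  enc_mlp :: mlp

record dec_layer =
  dec_self :: multi_head
  dec_cross :: multi_head
  dec_mlp :: mlp

definition enc_apply :: "fp_arith \<Rightarrow> enc_layer \<Rightarrow> flt mat \<Rightarrow> flt mat" where
  "enc_apply A L X =
     (let X' = fmat_add A (mhsa A (enc_self L) X) X
      in fmat_add A (mlp_apply A (enc_mlp L) X') X')"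

definition dec_apply :: "fp_arith \<Rightarrow> dec_layer \<Rightarrow> flt mat \<Rightarrow> flt mat \<Rightarrow> flt mat" where
  "dec_apply A L X Y =
     (let Y' = fmat_add A (mhsa_masked A (dec_self L) Y) Y;
          Y'' = fmat_add A (mhca A (dec_cross L) X Y') Y'
      in fmat_add A (mlp_apply A (dec_mlp L) Y'') Y'')"

text \<open>A token is \<open>Some a\<close> with \<open>a\<close> in the token set; \<open>None\<close> is \<open>BOS\<close>.\<close>

record 's transformer =
  embed :: "'s option \<Rightarrow> flt vec"
  enc_layers :: "enc_layer list"
  dec_layers :: "dec_layer list"
  Wout :: "flt mat"
  bout :: "flt vec"

definition tokens :: "'s set \<Rightarrow> 's option set" where
  "tokens \<Sigma> = insert None (Some ` \<Sigma>)"

definition wf_multi_head :: "fp_arith \<Rightarrow> nat \<Rightarrow> nat \<Rightarrow> nat \<Rightarrow> multi_head \<Rightarrow> bool" where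
  "wf_multi_head A d dk dv N \<longleftrightarrow> heads N \<noteq> [] \<and>
     (\<forall>H \<in> set (heads N).
        WQ H \<in> flt_mats A d dk \<and> WK H \<in> flt_mats A d dk \<and> WV H \<in> flt_mats A d dv) \<and>
     WO N \<in> flt_mats A (length (heads N) * dv) d"

definition wf_mlp :: "fp_arith \<Rightarrow> nat \<Rightarrow> nat \<Rightarrow> mlp \<Rightarrow> bool" where
  "wf_mlp A d dff M \<longleftrightarrow> W1 M \<in> flt_mats A d dff \<and> b1 M \<in> flt_vecs A dff \<and>
     W2 M \<in> flt_mats A dff d \<and> b2 M \<in> flt_vecs A d"

definition wf_transformer ::
  "fp_arith \<Rightarrow> 's set \<Rightarrow> nat \<times> nat \<times> nat \<times> nat \<times> nat \<Rightarrow> 's transformer \<Rightarrow> bool" where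
  "wf_transformer A \<Sigma> = (\<lambda>(d, dk, dv, dff, dout) T.
     d > 0 \<and> dk > 0 \<and> dv > 0 \<and> dff > 0 \<and> dout > 0 \<and>
     (\<forall>a \<in> tokens \<Sigma>. embed T a \<in> flt_vecs A d) \<and>
     (\<forall>L \<in> set (enc_layers T). wf_multi_head A d dk dv (enc_self L) \<and> wf_mlp A d dff (enc_mlp L)) \<and>
     (\<forall>L \<in> set (dec_layers T). wf_multi_head A d dk dv (dec_self L) \<and>
        wf_multi_head A d dk dv (dec_cross L) \<and> wf_mlp A d dff (dec_mlp L)) \<and>
     Wout T \<in> flt_mats A d dout \<and> bout T \<in> flt_vecs A dout)"

definition encoder :: "fp_arith \<Rightarrow> 's transformer \<Rightarrow> flt mat \<Rightarrow> flt mat" where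
  "encoder A T X = fold (enc_apply A) (enc_layers T) X"

definition decoder :: "fp_arith \<Rightarrow> 's transformer \<Rightarrow> flt mat \<Rightarrow> flt mat \<Rightarrow> flt mat" where
  "decoder A T X Y = fold (\<lambda>L. dec_apply A L X) (dec_layers T) Y"

definition out_head :: "fp_arith \<Rightarrow> 's transformer \<Rightarrow> flt mat \<Rightarrow> flt mat" where
  "out_head A T Y = add_bias A (fmat_mult A Y (Wout T)) (bout T)"

section \<open>Two-sorted graphs\<close>

record 's tsgraph =
  verts :: "nat set"
  edges :: "(nat \<times> nat) set"
  lab :: "nat \<Rightarrow> 's option"

definition two_sorted_graph :: "'s set \<Rightarrow> 's tsgraph \<Rightarrow> bool" where
  "two_sorted_graph \<Sigma> G \<longleftrightarrow>
     (\<exists>n. verts G = {1..n} \<and> edges G = {(i, i + 1) | i. 1 \<le> i \<and> i < n}) \<and>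
     lab G ` verts G \<subseteq> tokens \<Sigma> \<and>
     (\<exists>!w. w \<in> verts G \<and> lab G w = None)"

definition bos :: "'s tsgraph \<Rightarrow> nat" where
  "bos G = (THE w. w \<in> verts G \<and> lab G w = None)"

definition prefix_verts :: "'s tsgraph \<Rightarrow> nat set" where
  "prefix_verts G = {v \<in> verts G. v < bos G}"

definition suffix_verts :: "'s tsgraph \<Rightarrow> nat set" where
  "suffix_verts G = {v \<in> verts G. bos G \<le> v}"

definition embed_verts :: "'s transformer \<Rightarrow> 's tsgraph \<Rightarrow> nat set \<Rightarrow> flt mat" where
  "embed_verts T G U =
     mat_of_rows (dim_vec (embed T None)) (map (\<lambda>v. embed T (lab G v)) (sorted_list_of_set U))"

definition transformer_apply :: "fp_arith \<Rightarrow> 's transformer \<Rightarrow> 's tsgraph \<Rightarrow> flt mat" where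
  "transformer_apply A T G =
     out_head A T (decoder A T (encoder A T (embed_verts T G (prefix_verts G)))
       (embed_verts T G (suffix_verts G)))"

definition transformer_output :: "fp_arith \<Rightarrow> 's transformer \<Rightarrow> 's tsgraph \<Rightarrow> nat \<Rightarrow> flt vec" where
  "transformer_output A T G v = row (transformer_apply A T G) (v - bos G)"

section \<open>CPG-automata\<close>

record 's cpg =
  states :: "bool list set"
  init :: "'s option \<Rightarrow> bool list"
  cap :: nat
  trans :: "bool list \<Rightarrow> bool list multiset \<Rightarrow> bool list multiset \<Rightarrow> bool list"
  out_round :: nat
  out_length :: nat

definition cap_mset :: "nat \<Rightarrow> 'a multiset \<Rightarrow> 'a multiset" where
  "cap_mset k M = (\<Sum>x \<in> set_mset M. replicate_mset (min (count M x) k) x)"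

definition capped_msets :: "nat \<Rightarrow> 'a set \<Rightarrow> 'a multiset set" where
  "capped_msets k Q = {M. set_mset M \<subseteq> Q \<and> (\<forall>x. count M x \<le> k)}"

definition cpg_automaton :: "'s set \<Rightarrow> 's cpg \<Rightarrow> bool" where
  "cpg_automaton \<Sigma> C \<longleftrightarrow>
     (\<exists>m. states C \<subseteq> {x. length x = m} \<and> out_length C \<le> m) \<and>
     finite (states C) \<and> states C \<noteq> {} \<and>
     init C ` tokens \<Sigma> \<subseteq> states C \<and>
     (\<forall>x \<in> states C. \<forall>M \<in> capped_msets (cap C) (states C). \<forall>N \<in> capped_msets (cap C) (states C).
        trans C x M N \<in> states C) \<and>
     out_length C > 0"

primrec cpg_state :: "'s cpg \<Rightarrow> 's tsgraph \<Rightarrow> nat \<Rightarrow> nat \<Rightarrow> bool list" where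
  "cpg_state C G 0 = (\<lambda>v. init C (lab G v))"
| "cpg_state C G (Suc t) = (\<lambda>v. trans C (cpg_state C G t v)
     (cap_mset (cap C) (image_mset (cpg_state C G t) (mset_set {u \<in> verts G. u < bos G})))
     (cap_mset (cap C) (image_mset (cpg_state C G t) (mset_set {u \<in> verts G. bos G \<le> u \<and> u < v}))))"

definition cpg_output :: "'s cpg \<Rightarrow> 's tsgraph \<Rightarrow> nat \<Rightarrow> bool list" where
  "cpg_output C G v = take (out_length C) (cpg_state C G (out_round C) v)"

section \<open>Sanity checks\<close>

lemma count_cap_mset: "count (cap_mset k M) x = min (count M x) k"
proof -
  have "count (cap_mset k M) x =
      (\<Sum>y \<in> set_mset M. if y = x then min (count M x) k else 0)"
    unfolding cap_mset_def count_sum by (rule sum.cong) auto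
  also have "\<dots> = min (count M x) k"
    by (cases "x \<in># M") (simp_all add: not_in_iff)
  finally show ?thesis .
qed

lemma finite_format: "finite (format p q)"
proof -
  have "finite {bs :: bool list. length bs = q + p + 1}"
    using finite_lists_length_eq[of "UNIV :: bool set" "q + p + 1"] by simp
  then have "finite (Float ` {bs. length bs = q + p + 1})" by (rule finite_imageI)
  moreover have "normalised p q \<union> subnormalised p q \<subseteq> Float ` {bs. length bs = q + p + 1}"
    unfolding normalised_def subnormalised_def by blast
  ultimately have "finite (normalised p q \<union> subnormalised p q)" by (rule rev_finite_subset)
  then show ?thesis by (simp add: format_def)
qed

lemma zero_in_format:
  assumes "p > 0" "q > 0"
  shows "Float (replicate (q + p + 1) False) \<in> format p q"
proof -
  have "exp_field q (replicate (q + p + 1) False) = replicate q False"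
    by (simp add: exp_field_def min_def)
  moreover have "\<not> replicate (q + p + 1) False ! (q + 1)"
    using assms by (subst nth_replicate) auto
  ultimately show ?thesis
    unfolding format_def subnormalised_def by (simp del: replicate_Suc)
qed

lemma fval_zero:
  assumes "p > 0" "q > 0"
  shows "fval p q (Float (replicate (q + p + 1) False)) = Some 0"
proof -
  have "replicate (q + p + 1) False ! 1 \<noteq> inf_bits b p q ! 1" for b
  proof -
    have "\<not> replicate (q + p + 1) False ! 1" using assms by (subst nth_replicate) auto
    moreover have "inf_bits b p q ! 1" using assms by (simp add: inf_bits_def nth_append)
    ultimately show ?thesis by blast
  qed
  then have "replicate (q + p + 1) False \<noteq> inf_bits b p q" for b
    by metis
  moreover have "horner_sum of_bool 2 (replicate n False) = (0 :: nat)" for n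
    by (induction n) simp_all
  ultimately show ?thesis
    by (simp add: sig_field_def bin_val_def zero_ereal_def del: replicate_Suc)
qed

lemma wf_arith_exists:
  assumes "p > 0" "q > 0"
  shows "\<exists>A. wf_arith A \<and> prec A = p \<and> expw A = q"
proof -
  have fin: "finite (format p q - {NaN})" using finite_format by blast
  have ne: "format p q - {NaN} \<noteq> {}" unfolding format_def by blast
  define r where "r x = arg_min_on (\<lambda>f. \<bar>x - round_pos p q f\<bar>) (format p q - {NaN})" for x
  have r: "nearest_rounding p q r" unfolding nearest_rounding_def
  proof (intro allI conjI ballI)
    fix x show "r x \<in> format p q - {NaN}"
      unfolding r_def by (rule arg_min_if_finite(1)[OF fin ne])
    fix f assume "f \<in> format p q - {NaN}"
    then show "\<bar>x - round_pos p q (r x)\<bar> \<le> \<bar>x - round_pos p q f\<bar>"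
      unfolding r_def by (rule arg_min_least[OF fin ne])
  qed
  define z where "z = Float (replicate (q + p + 1) False)"
  have z: "z \<in> format p q" "fval p q z = Some 0"
    using zero_in_format[OF assms] fval_zero[OF assms] by (simp_all only: z_def)
  define e where "e f = (if f = NaN then NaN else z)" for f
  define A where "A = \<lparr>prec = p, expw = q, rnd = r, fexp = e,
    nan_bits = replicate (q + p + 1) True\<rparr>"
  have "NaN \<in> format p q" by (simp add: format_def)
  then have "wf_arith A"
    using assms r z unfolding wf_arith_def A_def e_def fminf_def by auto
  then show ?thesis by (intro exI[of _ A]) (simp add: A_def)
qed

lemma length_format: "Float bs \<in> format p q \<Longrightarrow> length bs = q + p + 1"
  by (auto simp: format_def normalised_def subnormalised_def inf_bits_def)

lemma finite_val_bound:
  assumes "p > 0" "f \<in> format p q" "fval p q f = Some (ereal r)"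
  shows "\<bar>r\<bar> < 2 powi (2 ^ q - bias q)"
proof -
  obtain bs where f: "f = Float bs" using assms(3) by (cases f) auto
  have len: "length bs = q + p + 1" using length_format assms(2) f by blast
  define s where "s = bin_val (sig_field q bs)"
  define e where "e = bin_val (exp_field q bs)"
  have horner: "horner_sum of_bool 2 xs < (2 :: nat) ^ length xs" for xs :: "bool list"
  proof (induction xs)
    case (Cons x xs)
    then show ?case by (cases x) simp_all
  qed simp
  have bv: "bin_val xs < 2 ^ length xs" for xs
    using horner[of "rev xs"] by (simp add: bin_val_def)
  have s: "s < 2 ^ p" using bv[of "sig_field q bs"] len by (simp add: s_def sig_field_def)
  have s': "real s < 2 ^ p" using s by (metis of_nat_less_iff of_nat_numeral of_nat_power)
  have e: "e < 2 ^ q" using bv[of "exp_field q bs"] len by (simp add: e_def exp_field_def)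
  have r: "r = (-1) ^ of_bool (bs ! 0) * (real s / 2 ^ (p - 1)) * 2 powi (int e - bias q)"
    using assms(3) by (auto simp: f s_def e_def split: if_splits)
  have "\<bar>r\<bar> = real s / 2 ^ (p - 1) * 2 powi (int e - bias q)"
    by (simp add: r abs_mult power_abs)
  also have "\<dots> < 2 ^ p / 2 ^ (p - 1) * 2 powi (int e - bias q)"
    using s' by (intro mult_strict_right_mono divide_strict_right_mono) simp_all
  also have "\<dots> = 2 * 2 powi (int e - bias q)"
    using assms(1) by (cases p) simp_all
  also have "\<dots> = 2 powi (int e - bias q + 1)"
    by (simp add: power_int_add)
  also have "\<dots> \<le> 2 powi (2 ^ q - bias q)"
  proof (rule power_int_increasing)
    have "int e < 2 ^ q" using e by (metis of_nat_less_iff of_nat_numeral of_nat_power)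
    then show "int e - bias q + 1 \<le> 2 ^ q - bias q" by linarith
  qed simp
  finally show ?thesis .
qed

lemma val_inf [simp]: "val A (finf A) = Some \<infinity>" "val A (fminf A) = Some (-\<infinity>)"
  by (simp_all add: finf_def fminf_def inf_bits_def)

lemma val_rnd:
  assumes A: "wf_arith A" and f: "f \<in> floats A" "val A f = Some (ereal r)"
  shows "val A (rnd A r) = Some (ereal r)"
proof -
  let ?p = "prec A" and ?q = "expw A"
  have nr: "nearest_rounding ?p ?q (rnd A)" and p: "?p > 0" using A by (simp_all add: wf_arith_def)
  have fn: "f \<in> floats A - {NaN}" using f by auto
  have pos: "round_pos ?p ?q f = r" using f by (simp add: round_pos_def)
  have "\<bar>r - round_pos ?p ?q (rnd A r)\<bar> \<le> \<bar>r - round_pos ?p ?q f\<bar>"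
    using nr fn unfolding nearest_rounding_def by blast
  then have eq: "round_pos ?p ?q (rnd A r) = r" by (simp add: pos)
  have "rnd A r \<noteq> NaN" using nr unfolding nearest_rounding_def by blast
  then obtain bs where "rnd A r = Float bs" by (cases "rnd A r") auto
  then obtain v where v: "val A (rnd A r) = Some v" by simp
  have bd: "\<bar>r\<bar> < 2 powi (2 ^ ?q - bias ?q)" by (rule finite_val_bound[OF p f])
  show ?thesis
    using v eq bd by (cases v) (auto simp: round_pos_def abs_less_iff)
qed

lemma fround_in_floats: "wf_arith A \<Longrightarrow> fround A x \<in> floats A"
  unfolding fround_def wf_arith_def nearest_rounding_def
  by (auto simp: finf_def fminf_def format_def split: option.splits ereal.splits)

lemma fadd_in_floats: "wf_arith A \<Longrightarrow> fadd A x y \<in> floats A"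
  by (simp add: fadd_def lift_op_def fround_in_floats)

lemma val_fadd_zero:
  assumes "wf_arith A" "x \<in> floats A" "val A y = Some 0"
  shows "val A (fadd A x y) = val A x"
proof (cases "val A x")
  case None
  then show ?thesis by (simp add: fadd_def lift_op_def fround_def)
next
  case (Some v)
  then show ?thesis
    using assms val_rnd[OF assms(1,2)]
    by (cases v) (auto simp: fadd_def lift_op_def fround_def exact_add_def)
qed

lemma val_foldl_fadd:
  assumes "wf_arith A"
  shows "x \<in> floats A \<Longrightarrow> y \<in> floats A \<Longrightarrow> val A x = val A y \<Longrightarrow>
    val A (foldl (fadd A) x zs) = val A (foldl (fadd A) y (filter (\<lambda>z. val A z \<noteq> Some 0) zs))"
proof (induction zs arbitrary: x y)
  case (Cons z zs)
  show ?case
  proof (cases "val A z = Some 0")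
    case True
    then show ?thesis
      using Cons.IH[of "fadd A x z" y] Cons.prems val_fadd_zero[OF assms, of x z]
        fadd_in_floats[OF assms] by simp
  next
    case False
    have "fadd A x z = fadd A y z" using Cons.prems(3) by (simp add: fadd_def lift_op_def)
    then show ?thesis
      using False Cons.IH[of "fadd A x z" "fadd A y z"] fadd_in_floats[OF assms] by simp
  qed
qed simp

lemma val_fsum_nonzero:
  assumes "wf_arith A"
  shows "val A (fsum A xs) = val A (fsum A (filter (\<lambda>z. val A z \<noteq> Some 0) xs))"
proof -
  have "fzero A \<in> floats A"
    using assms zero_in_format unfolding fzero_def wf_arith_def by blast
  from val_foldl_fadd[OF assms this this refl] show ?thesis
    unfolding fsum_def filter_sort[symmetric] .
qed

lemma masked_mult_eq:
  assumes A: "wf_arith A"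
    and dims: "X \<in> carrier_mat n n" "Y \<in> carrier_mat n m" "i < n" "j < m"
    and masked: "\<And>k. i \<le> k \<Longrightarrow> k < n \<Longrightarrow>
      val A (X $$ (i, k)) = Some 0 \<and> (\<exists>r. val A (Y $$ (k, j)) = Some (ereal r))"
  shows "val A (masked_mult A X Y $$ (i, j)) = val A (fmat_mult A X Y $$ (i, j))"
proof -
  let ?f = "\<lambda>k. fmult A (X $$ (i, k)) (Y $$ (k, j))"
  let ?P = "\<lambda>z. val A z \<noteq> Some 0"
  have z: "fzero A \<in> floats A" "val A (fzero A) = Some (ereal 0)"
    using A zero_in_format fval_zero unfolding fzero_def wf_arith_def zero_ereal_def by blast+
  have zero: "val A (?f k) = Some 0" if "i \<le> k" "k < n" for k
    using masked[OF that] val_rnd[OF A z]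
    by (auto simp: fmult_def lift_op_def exact_mult_def fround_def zero_ereal_def)
  have vis: "k < i" if "k < n" "?P (?f k)" for k
    using zero[of k] that by (metis leI)
  have "filter ?P (map ?f (filter (\<lambda>k. k < i) [0..<n])) = filter ?P (map ?f [0..<n])"
    unfolding filter_map filter_filter
    by (rule arg_cong[where f = "map ?f"], rule filter_cong) (auto dest: vis)
  then have "val A (fsum A (map ?f (filter (\<lambda>k. k < i) [0..<n]))) = val A (fsum A (map ?f [0..<n]))"
    using val_fsum_nonzero[OF A, of "map ?f (filter (\<lambda>k. k < i) [0..<n])"]
      val_fsum_nonzero[OF A, of "map ?f [0..<n]"] by (simp only:)
  then show ?thesis using dims by (simp add: masked_mult_def fmat_mult_def)
qed

end

theory Submission
  imports Defs
begin

text \<open>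
  Adding the same number over and over in a floating-point format moves the accumulator monotonically
  through a finite set, so the sum becomes stationary after boundedly many additions. Since sums are
  computed in increasing order, equal summands are added consecutively, and a sum depends only on the
  multiset of its summands with multiplicities capped at a constant. Every row of an encoder
  or decoder layer is therefore a function of the previous row and of capped multisets of rows, and
  an automaton with the finitely many float vectors as states can perform one layer per round.
\<close>

section \<open>Multisets up to capped multiplicities\<close>

text \<open>Rounding to nearest is what makes the accumulator monotone: before each addition it is
  itself a float, so the rounded result cannot land on the wrong side of it, however ties are
  broken. Once its value stands still it stands still for good, because an addition reads only the
  values of its arguments. The number of floats bounds the length of such a chain for every summand
  and every starting point, so one cap serves all sums of all layers. Two obstacles remain. The
  zeros of both signs have the same value but different bits, so the sums are analysed through
  values, and several facts are equalities of values only. And the softmax of a masked row extends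
  over the later suffix positions, which a vertex never sees and cannot count; their common score
  -\<infinity> is therefore represented by a single extra element. A transition function is not told
  the round, so the state has to carry its own clock, which selects the layer. A state must also
  begin with the output bits, although these do not determine it.\<close>

definition cap_eq :: "nat \<Rightarrow> 'a multiset \<Rightarrow> 'a multiset \<Rightarrow> bool" where
  "cap_eq k M N \<longleftrightarrow> (\<forall>x. min (count M x) k = min (count N x) k)"

lemma cap_eq_refl [simp]: "cap_eq k M M"
  by (simp add: cap_eq_def)

lemma cap_eq_cap_mset: "cap_eq k (cap_mset k M) M"
  by (simp add: cap_eq_def count_cap_mset)

lemma cap_eq_set_mset:
  assumes "cap_eq k M N" "k > 0"
  shows "set_mset M = set_mset N"
proof -
  have "count M x = 0 \<longleftrightarrow> count N x = 0" for x
  proof -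
    have "min (count M x) k = min (count N x) k" using assms(1) by (simp add: cap_eq_def)
    then show ?thesis
      using assms(2) by (cases "count M x"; cases "count N x") (auto simp: min_def split: if_splits)
  qed
  then show ?thesis by (metis not_in_iff subsetI subset_antisym)
qed

lemma cap_eq_union:
  assumes "cap_eq k M N"
  shows "cap_eq k (P + M) (P + N)"
proof -
  have "min (count P x + count M x) k = min (count P x + count N x) k" for x
  proof -
    have "min (count M x) k = min (count N x) k" using assms by (simp add: cap_eq_def)
    then show ?thesis by (auto simp: min_def split: if_splits)
  qed
  then show ?thesis by (simp add: cap_eq_def)
qed

lemma min_sum_cong:
  fixes f g :: "'a \<Rightarrow> nat"
  assumes "finite F" "\<And>x. x \<in> F \<Longrightarrow> min (f x) k = min (g x) k"
  shows "min (sum f F) k = min (sum g F) k"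
  using assms
proof (induction F rule: finite_induct)
  case (insert x F)
  have "min (f x) k = min (g x) k" "min (sum f F) k = min (sum g F) k"
    using insert by auto
  then show ?case using insert(1,2) by (auto simp: min_def split: if_splits)
qed simp

text \<open>A multiplicity in the image is a sum of multiplicities over a fibre, and capped summands
  determine a capped sum. Hence a cap imposed on states passes to the scores, exponentials and
  weighted values computed from them.\<close>

lemma cap_eq_image_mset:
  assumes "cap_eq k M N"
  shows "cap_eq k (image_mset f M) (image_mset f N)"
proof (cases "k = 0")
  case False
  then have "set_mset M = set_mset N" using cap_eq_set_mset[OF assms] by simp
  moreover have "min (\<Sum>x\<in>f -` {y} \<inter> set_mset N. count M x) k
      = min (\<Sum>x\<in>f -` {y} \<inter> set_mset N. count N x) k" for y
    using assms by (intro min_sum_cong) (auto simp: cap_eq_def)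
  ultimately show ?thesis by (simp add: cap_eq_def count_image_mset)
qed (simp add: cap_eq_def)

section \<open>Saturation of floating-point sums\<close>

text \<open>If \<open>h\<close> rose strictly at each of the first \<open>card S + 1\<close> steps,
  the iterates would be too many distinct elements of \<open>S\<close>; so it stalls at some step.
  The assumption \<open>fix_pt\<close> then makes \<open>g x\<close> a fixed point rather than
  \<open>x\<close>, since in the application \<open>x\<close> and \<open>g x\<close> may be the two
  zeros.\<close>

lemma iterate_stabilises:
  fixes h :: "'a \<Rightarrow> 'b::linorder"
  assumes fin: "finite S" and closed: "g ` S \<subseteq> S"
    and mono: "\<And>x. x \<in> S \<Longrightarrow> h x \<le> h (g x)"
    and fix_pt: "\<And>x. x \<in> S \<Longrightarrow> h x = h (g x) \<Longrightarrow> g (g x) = g x"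
    and a: "a \<in> S" and n: "card S < n" and m: "card S < m"
  shows "(g ^^ n) a = (g ^^ m) a"
proof -
  have in_S: "(g ^^ i) a \<in> S" for i
    using a closed by (induction i) auto
  have "\<exists>i \<le> card S. h ((g ^^ i) a) = h ((g ^^ Suc i) a)"
  proof (rule ccontr)
    assume "\<not> ?thesis"
    then have strict: "h ((g ^^ i) a) < h ((g ^^ Suc i) a)" if "i \<le> card S" for i
      using mono[OF in_S[of i]] that by (auto simp: less_le)
    have less: "h ((g ^^ i) a) < h ((g ^^ j) a)" if "i < j" "j \<le> Suc (card S)" for i j
      using that
    proof (induction j)
      case (Suc j)
      then show ?case using strict[of j] by (cases "i = j") force+
    qed simp
    have "inj_on (\<lambda>i. (g ^^ i) a) {..Suc (card S)}"
      by (rule linorder_inj_onI) (use less in fastforce)+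
    moreover have "(\<lambda>i. (g ^^ i) a) ` {..Suc (card S)} \<subseteq> S" using in_S by blast
    ultimately have "card {..Suc (card S)} \<le> card S" by (rule card_inj_on_le[OF _ _ fin])
    then show False by simp
  qed
  then obtain i where i: "i \<le> card S" "h ((g ^^ i) a) = h ((g ^^ Suc i) a)" by blast
  have fixed: "g ((g ^^ Suc i) a) = (g ^^ Suc i) a" using fix_pt[OF in_S[of i]] i(2) by simp
  have "(g ^^ (Suc i + j)) a = (g ^^ Suc i) a" for j
    by (induction j) (use fixed in simp_all)
  from this[of "n - Suc i"] this[of "m - Suc i"] show ?thesis using i(1) n m by simp
qed

text \<open>Addition of a summand of which only the value is known. It agrees with
  \<open>fadd\<close> on every summand other than \<open>NaN\<close> and turns a run of equal
  summands into an iterate of one function, even if both zeros occur in the run.\<close>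

definition add_val :: "fp_arith \<Rightarrow> ereal \<Rightarrow> flt \<Rightarrow> flt" where
  "add_val A r x = fround A (Option.bind (val A x) (\<lambda>u. exact_add u r))"

lemma add_val_in_floats: "wf_arith A \<Longrightarrow> add_val A r x \<in> floats A"
  by (simp add: add_val_def fround_in_floats)

lemma add_val_cong: "val A x = val A y \<Longrightarrow> add_val A r x = add_val A r y"
  by (simp add: add_val_def)

lemma add_val_NaN [simp]: "add_val A r NaN = NaN"
  by (simp add: add_val_def fround_def)

lemma val_eq_None_iff [simp]: "val A x = None \<longleftrightarrow> x = NaN"
  by (cases x) auto

lemma val_eq_MInfty_iff: "val A x = Some (-\<infinity>) \<longleftrightarrow> x = fminf A"
  by (cases x) (auto simp: fminf_def inf_bits_def)

lemma fzero_in_floats: "wf_arith A \<Longrightarrow> fzero A \<in> floats A"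
  using zero_in_format unfolding fzero_def wf_arith_def by blast

text \<open>The float \<open>a\<close> competes for being nearest to \<open>y\<close>, and any float
  beyond \<open>a\<close> as seen from \<open>y\<close> is farther away. For infinite results,
  \<open>finite_val_bound\<close> places the stand-in position of infinity outside the range of
  finite floats.\<close>

lemma rnd_mono:
  assumes A: "wf_arith A" and a: "a \<in> floats A" "val A a = Some (ereal u)"
  obtains v where "val A (rnd A y) = Some v" "u \<le> y \<Longrightarrow> ereal u \<le> v" "y \<le> u \<Longrightarrow> v \<le> ereal u"
proof -
  let ?p = "prec A" and ?q = "expw A"
  have nr: "nearest_rounding ?p ?q (rnd A)" and p: "?p > 0" using A by (simp_all add: wf_arith_def)
  have "a \<noteq> NaN" using a by auto
  then have near: "\<bar>y - round_pos ?p ?q (rnd A y)\<bar> \<le> \<bar>y - u\<bar>"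
    using nr a unfolding nearest_rounding_def by (force simp: round_pos_def)
  have "rnd A y \<noteq> NaN" using nr unfolding nearest_rounding_def by blast
  then obtain v where v: "val A (rnd A y) = Some v" using val_eq_None_iff by blast
  have bd: "\<bar>u\<bar> < 2 powi (2 ^ ?q - bias ?q)" by (rule finite_val_bound[OF p a])
  have "ereal u \<le> v" if "u \<le> y"
    using near bd v that by (cases v) (auto simp: round_pos_def)
  moreover have "v \<le> ereal u" if "y \<le> u"
    using near bd v that by (cases v) (auto simp: round_pos_def)
  ultimately show ?thesis using v that by blast
qed

text \<open>The potential for \<open>iterate_stabilises\<close>: the accumulator measured in the
  direction of the summand \<open>r\<close>. The absorbing \<open>NaN\<close> is put on top, so that
  passing from an infinity to \<open>NaN\<close> by adding the opposite infinity also counts as a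
  rise.\<close>

definition drift :: "fp_arith \<Rightarrow> ereal \<Rightarrow> flt \<Rightarrow> ereal" where
  "drift A r x = (case val A x of None \<Rightarrow> \<infinity> | Some v \<Rightarrow> if r \<ge> 0 then v else - v)"

lemma drift_add_val:
  assumes A: "wf_arith A" and a: "a \<in> floats A"
  shows "drift A r a \<le> drift A r (add_val A r a)"
    and "drift A r a = drift A r (add_val A r a) \<Longrightarrow>
      add_val A r (add_val A r a) = add_val A r a"
proof -
  \<comment> \<open>Equal drift is strengthened to equal value, after which the next addition
    returns the same float. The drift alone does not separate \<open>NaN\<close> from the infinity
    in the direction of \<open>r\<close>, but adding \<open>r\<close> never leads from that infinity
    to \<open>NaN\<close>.\<close>
  have "drift A r a \<le> drift A r (add_val A r a) \<and>
    (drift A r a = drift A r (add_val A r a) \<longrightarrow> val A (add_val A r a) = val A a)"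
  proof (cases "val A a")
    case None
    then show ?thesis by simp
  next
    case (Some v)
    show ?thesis
    proof (cases v)
      case (real u)
      show ?thesis
      proof (cases r)
        case (real s)
        \<comment> \<open>The float that the rounded result cannot cross is the accumulator
          itself.\<close>
        obtain v' where v': "val A (rnd A (u + s)) = Some v'"
          "u \<le> u + s \<Longrightarrow> ereal u \<le> v'" "u + s \<le> u \<Longrightarrow> v' \<le> ereal u"
          using rnd_mono[OF A a, of u "u + s"] Some \<open>v = ereal u\<close> by auto
        have "add_val A r a = rnd A (u + s)"
          using Some real \<open>v = ereal u\<close> by (simp add: add_val_def exact_add_def fround_def)
        then show ?thesis using v' Some real \<open>v = ereal u\<close>
          by (cases v'; cases "0 \<le> s") (auto simp: drift_def)
      qed (use Some real in \<open>auto simp: add_val_def exact_add_def fround_def drift_def\<close>)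
    qed (use Some in \<open>cases r; auto simp: add_val_def exact_add_def fround_def drift_def\<close>)+
  qed
  then show "drift A r a \<le> drift A r (add_val A r a)"
    and "drift A r a = drift A r (add_val A r a) \<Longrightarrow>
      add_val A r (add_val A r a) = add_val A r a"
    using add_val_cong by blast+
qed

text \<open>Stationarity needs more than \<open>card (floats A)\<close> additions, hence the
  successor. It also makes the bound positive, so that capped equality preserves supports.\<close>

definition sat_bound :: "fp_arith \<Rightarrow> nat" where
  "sat_bound A = Suc (card (floats A))"

lemma add_val_saturates:
  assumes A: "wf_arith A" and a: "a \<in> floats A"
    and nm: "min n (sat_bound A) = min m (sat_bound A)"
  shows "(add_val A r ^^ n) a = (add_val A r ^^ m) a"
proof (cases "n = m")
  case False
  then have "card (floats A) < n" "card (floats A) < m"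
    using nm by (auto simp: sat_bound_def min_def split: if_splits)
  then show ?thesis
    using add_val_in_floats[OF A] drift_add_val[OF A]
    by (intro iterate_stabilises[OF finite_format _ _ _ a, where h = "drift A r"]) auto
qed simp

section \<open>Sums as folds over blocks of equal values\<close>

lemma sorted_concat_replicate:
  assumes "sorted xs"
  shows "sorted (concat (map (\<lambda>x. replicate (c x) x) xs))"
  using assms by (induction xs) (auto simp: sorted_append)

lemma sorted_list_of_multiset_conv_concat:
  "sorted_list_of_multiset M =
    concat (map (\<lambda>x. replicate (count M x) x) (sorted_list_of_set (set_mset M)))"
proof -
  let ?ys = "concat (map (\<lambda>x. replicate (count M x) x) (sorted_list_of_set (set_mset M)))"
  have "mset (concat (map (\<lambda>x. replicate (c x) x) xs)) = (\<Sum>x\<in>set xs. replicate_mset (c x) x)"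
    if "distinct xs" for xs :: "'a list" and c
    using that by (induction xs) auto
  from this[OF distinct_sorted_list_of_set]
  have "mset ?ys = (\<Sum>x\<in>set_mset M. replicate_mset (count M x) x)"
    by simp
  also have "\<dots> = M"
  proof (rule multiset_eqI)
    fix x
    have "count (\<Sum>y\<in>set_mset M. replicate_mset (count M y) y) x
        = (\<Sum>y\<in>set_mset M. if y = x then count M x else 0)"
      unfolding count_sum by (rule sum.cong) auto
    then show "count (\<Sum>y\<in>set_mset M. replicate_mset (count M y) y) x = count M x"
      by (cases "x \<in># M") (simp_all add: not_in_iff)
  qed
  finally have "mset ?ys = M" .
  moreover have "sorted ?ys" by (rule sorted_concat_replicate) simp
  ultimately show ?thesis
    by (metis sorted_list_of_multiset_mset sorted_sort_id)
qed

lemma foldl_fadd_NaN: "x = NaN \<or> NaN \<in> set xs \<Longrightarrow> foldl (fadd A) x xs = NaN"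
proof (induction xs arbitrary: x)
  case (Cons y xs)
  have "fadd A x y = NaN \<or> NaN \<in> set xs"
    using Cons.prems
    by (cases "x = NaN"; auto simp: fadd_def lift_op_def fround_def bind_eq_None_conv
        split: option.splits)
  then show ?case using Cons.IH by simp
qed simp

lemma fsum_NaN: "NaN \<in> set xs \<Longrightarrow> fsum A xs = NaN"
  unfolding fsum_def by (rule foldl_fadd_NaN) simp

lemma foldl_fadd_conv_add_val:
  "NaN \<notin> set xs \<Longrightarrow> foldl (fadd A) x xs = foldl (\<lambda>x r. add_val A r x) x (map (fkey A) xs)"
proof (induction xs arbitrary: x)
  case (Cons y xs)
  then obtain r where "val A y = Some r" by (metis val_eq_None_iff list.set_intros(1) not_None_eq)
  then have "fadd A x y = add_val A (fkey A y) x"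
    by (simp add: fadd_def lift_op_def add_val_def fkey_def)
  then show ?case using Cons by simp
qed simp

text \<open>Taking keys after sorting gives the sorted list of keys, which forgets the order among
  floats with equal keys. \<open>NaN\<close> is kept out because it shares its key with positive
  infinity.\<close>

lemma fsum_conv_add_val:
  assumes "NaN \<notin> set xs"
  shows "fsum A xs = foldl (\<lambda>x r. add_val A r x) (fzero A)
    (sorted_list_of_multiset (image_mset (fkey A) (mset xs)))"
proof -
  have "map (fkey A) (sort_key (fkey A) xs) = sort (map (fkey A) xs)"
    by (rule properties_for_sort[symmetric]) simp_all
  then show ?thesis
    using assms foldl_fadd_conv_add_val[of "sort_key (fkey A) xs"]
    by (simp add: fsum_def flip: sorted_list_of_multiset_mset)
qed

lemma foldl_replicate: "foldl (\<lambda>x r. f r x) x (replicate n r) = (f r ^^ n) x"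
  by (induction n arbitrary: x) (simp_all add: funpow_swap1)

text \<open>On each block the two iterates agree by saturation, whatever float they start from; the
  accumulators therefore coincide again when the next block begins.\<close>

lemma foldl_add_val_cap_eq:
  assumes A: "wf_arith A" and eq: "\<And>r. min (c r) (sat_bound A) = min (c' r) (sat_bound A)"
  shows "a \<in> floats A \<Longrightarrow>
    foldl (\<lambda>x r. add_val A r x) a (concat (map (\<lambda>r. replicate (c r) r) rs)) =
    foldl (\<lambda>x r. add_val A r x) a (concat (map (\<lambda>r. replicate (c' r) r) rs))"
proof (induction rs arbitrary: a)
  case (Cons r rs)
  have "(add_val A r ^^ n) a \<in> floats A" for n
    by (induction n) (simp_all add: add_val_in_floats[OF A] Cons.prems)
  then show ?case
    using Cons.IH add_val_saturates[OF A Cons.prems eq] by (simp add: foldl_replicate)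
qed simp

lemma fsum_cap_eq:
  assumes A: "wf_arith A" and eq: "cap_eq (sat_bound A) (mset xs) (mset ys)"
  shows "fsum A xs = fsum A ys"
proof -
  have sets: "set xs = set ys"
    using cap_eq_set_mset[OF eq] by (simp add: sat_bound_def)
  show ?thesis
  proof (cases "NaN \<in> set xs")
    case True
    then show ?thesis using sets by (simp add: fsum_NaN)
  next
    case False
    let ?M = "image_mset (fkey A) (mset xs)" and ?N = "image_mset (fkey A) (mset ys)"
    \<comment> \<open>Passing to keys can merge the two zeros, whose multiplicities then add up;
      capped equality survives this.\<close>
    have eq': "cap_eq (sat_bound A) ?M ?N" using eq by (rule cap_eq_image_mset)
    then have same: "set_mset ?M = set_mset ?N"
      by (rule cap_eq_set_mset) (simp add: sat_bound_def)
    have "foldl (\<lambda>x r. add_val A r x) (fzero A) (sorted_list_of_multiset ?M) =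
      foldl (\<lambda>x r. add_val A r x) (fzero A) (sorted_list_of_multiset ?N)"
      unfolding sorted_list_of_multiset_conv_concat same
      by (rule foldl_add_val_cap_eq[OF A _ fzero_in_floats[OF A]])
        (use eq' in \<open>simp add: cap_eq_def del: count_image_mset\<close>)
    then show ?thesis using False sets by (simp add: fsum_conv_add_val)
  qed
qed

definition fsum_mset :: "fp_arith \<Rightarrow> flt multiset \<Rightarrow> flt" where
  "fsum_mset A M = fsum A (SOME xs. mset xs = M)"

lemma mset_some: "mset (SOME xs. mset xs = M) = M"
  by (rule someI_ex) (rule ex_mset)

text \<open>Independence of the order is the case of \<open>fsum_cap_eq\<close> in which both lists
  have the same multiset; it makes the choice inside \<open>fsum_mset\<close> immaterial.\<close>

lemma fsum_conv_mset: "wf_arith A \<Longrightarrow> fsum A xs = fsum_mset A (mset xs)"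
  unfolding fsum_mset_def by (rule fsum_cap_eq) (simp_all add: mset_some)

lemma fsum_mset_cap_eq:
  "wf_arith A \<Longrightarrow> cap_eq (sat_bound A) M N \<Longrightarrow> fsum_mset A M = fsum_mset A N"
  unfolding fsum_mset_def by (rule fsum_cap_eq) (simp_all add: mset_some)

section \<open>Transformer layers as functions of a row and a multiset of rows\<close>

definition row_mult :: "fp_arith \<Rightarrow> flt vec \<Rightarrow> flt mat \<Rightarrow> flt vec" where
  "row_mult A x W = vec (dim_col W)
     (\<lambda>j. fsum A (map (\<lambda>k. fmult A (x $ k) (W $$ (k, j))) [0..<dim_row W]))"

definition row_add :: "fp_arith \<Rightarrow> flt vec \<Rightarrow> flt vec \<Rightarrow> flt vec" where
  "row_add A x y = vec (dim_vec x) (\<lambda>j. fadd A (x $ j) (y $ j))"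

definition row_mlp :: "fp_arith \<Rightarrow> mlp \<Rightarrow> flt vec \<Rightarrow> flt vec" where
  "row_mlp A M x = row_add A
     (row_mult A (map_vec (frelu A) (row_add A (row_mult A x (W1 M)) (b1 M))) (W2 M)) (b2 M)"

definition score :: "fp_arith \<Rightarrow> head \<Rightarrow> flt vec \<Rightarrow> flt vec \<Rightarrow> flt" where
  "score A H y x = fdiv A
     (fsum A (map (\<lambda>k. fmult A (row_mult A y (WQ H) $ k) (row_mult A x (WK H) $ k))
       [0..<dim_col (WK H)]))
     (fsqrt A (fround A (Some (ereal (real (dim_col (WQ H)))))))"

definition softmax_weight :: "fp_arith \<Rightarrow> flt multiset \<Rightarrow> flt \<Rightarrow> flt" where
  "softmax_weight A Z s =
     (if set_mset Z \<subseteq> {fminf A} then fzero A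
      else let \<beta> = (if NaN \<in># Z then NaN else arg_max_on (fkey A) (set_mset Z))
           in fdiv A (fexp A (fsub A s \<beta>))
                (fsum_mset A (image_mset (\<lambda>y. fexp A (fsub A y \<beta>)) Z)))"

text \<open>
  The multiset \<open>P\<close> holds extra scores that enter the softmax only; it accounts for the masked
  positions.
\<close>

definition row_attention ::
  "fp_arith \<Rightarrow> flt multiset \<Rightarrow> head \<Rightarrow> flt vec multiset \<Rightarrow> flt vec \<Rightarrow> flt vec" where
  "row_attention A P H M y = vec (dim_col (WV H)) (\<lambda>c. fsum_mset A (image_mset
     (\<lambda>x. fmult A (softmax_weight A (P + image_mset (score A H y) M) (score A H y x))
       (row_mult A x (WV H) $ c)) M))"

definition row_multi_head ::
  "fp_arith \<Rightarrow> flt multiset \<Rightarrow> multi_head \<Rightarrow> flt vec multiset \<Rightarrow> flt vec \<Rightarrow> flt vec" where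
  "row_multi_head A P N M y = row_mult A
     (vec_of_list (concat (map (\<lambda>H. list_of_vec (row_attention A P H M y)) (heads N)))) (WO N)"

definition row_enc :: "fp_arith \<Rightarrow> enc_layer \<Rightarrow> flt vec multiset \<Rightarrow> flt vec \<Rightarrow> flt vec" where
  "row_enc A L M x =
     (let x' = row_add A (row_multi_head A {#} (enc_self L) M x) x
      in row_add A (row_mlp A (enc_mlp L) x') x')"

definition row_dec ::
  "fp_arith \<Rightarrow> dec_layer \<Rightarrow> flt vec multiset \<Rightarrow> flt vec multiset \<Rightarrow> flt vec \<Rightarrow> flt vec" where
  "row_dec A L M N y =
     (let y' = row_add A (row_multi_head A {#fminf A#} (dec_self L) N y) y;
          y'' = row_add A (row_multi_head A {#} (dec_cross L) M y') y'
      in row_add A (row_mlp A (dec_mlp L) y'') y'')"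

abbreviation rows_below :: "flt mat \<Rightarrow> nat \<Rightarrow> flt vec multiset" where
  "rows_below X n \<equiv> image_mset (row X) (mset_set {0..<n})"

section \<open>Invariance of the row functions under capped equality\<close>

lemma softmax_weight_cap_eq:
  assumes A: "wf_arith A" and eq: "cap_eq (sat_bound A) Z Z'"
  shows "softmax_weight A Z s = softmax_weight A Z' s"
proof -
  \<comment> \<open>The maximum is chosen from the support, so it is the same float on both sides;
    multiplicities affect only the denominator.\<close>
  have "set_mset Z = set_mset Z'"
    by (rule cap_eq_set_mset[OF eq]) (simp add: sat_bound_def)
  then show ?thesis
    using fsum_mset_cap_eq[OF A cap_eq_image_mset[OF eq]]
    unfolding softmax_weight_def by simp
qed

lemma row_multi_head_cap_eq:
  assumes A: "wf_arith A" and eq: "cap_eq (sat_bound A) M M'"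
  shows "row_multi_head A P N M y = row_multi_head A P N M' y"
proof -
  have "row_attention A P H M y = row_attention A P H M' y" for H
    using softmax_weight_cap_eq[OF A cap_eq_union[OF cap_eq_image_mset[OF eq]]]
      fsum_mset_cap_eq[OF A cap_eq_image_mset[OF eq]]
    by (simp add: row_attention_def)
  then show ?thesis by (simp add: row_multi_head_def)
qed

lemma row_enc_cap_eq:
  "wf_arith A \<Longrightarrow> cap_eq (sat_bound A) M M' \<Longrightarrow> row_enc A L M x = row_enc A L M' x"
  using row_multi_head_cap_eq[of A M M'] by (simp add: row_enc_def)

lemma row_dec_cap_eq:
  "wf_arith A \<Longrightarrow> cap_eq (sat_bound A) M M' \<Longrightarrow> cap_eq (sat_bound A) N N' \<Longrightarrow>
    row_dec A L M N y = row_dec A L M' N' y"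
  using row_multi_head_cap_eq[of A M M'] row_multi_head_cap_eq[of A N N']
  by (simp add: row_dec_def)

text \<open>Rounding lands in the format for arbitrary arguments. Since a layer ends with a residual
  addition, this gives closure of the state set under the layer functions.\<close>

lemma row_add_in_flt_vecs: "wf_arith A \<Longrightarrow> row_add A x y \<in> flt_vecs A (dim_vec x)"
  unfolding flt_vecs_def row_add_def by (auto intro: fadd_in_floats)

lemma dim_row_mult [simp]: "dim_vec (row_mult A x W) = dim_col W"
  by (simp add: row_mult_def)

lemma dim_row_add [simp]: "dim_vec (row_add A x y) = dim_vec x"
  by (simp add: row_add_def)

lemma dim_row_mlp [simp]: "dim_vec (row_mlp A M x) = dim_col (W2 M)"
  by (simp add: row_mlp_def)

lemma row_enc_in_flt_vecs:
  "wf_arith A \<Longrightarrow> row_enc A L M x \<in> flt_vecs A (dim_col (W2 (enc_mlp L)))"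
  unfolding row_enc_def Let_def by (rule row_add_in_flt_vecs[of A "row_mlp A _ _", unfolded dim_row_mlp])

lemma row_dec_in_flt_vecs:
  "wf_arith A \<Longrightarrow> row_dec A L M N x \<in> flt_vecs A (dim_col (W2 (dec_mlp L)))"
  unfolding row_dec_def Let_def by (rule row_add_in_flt_vecs[of A "row_mlp A _ _", unfolded dim_row_mlp])

section \<open>Rows of matrix operations and of unmasked attention\<close>

lemma dim_fmat_mult [simp]:
  "dim_row (fmat_mult A X Y) = dim_row X" "dim_col (fmat_mult A X Y) = dim_col Y"
  by (simp_all add: fmat_mult_def)

lemma dim_fmat_add [simp]:
  "dim_row (fmat_add A X Y) = dim_row X" "dim_col (fmat_add A X Y) = dim_col X"
  by (simp_all add: fmat_add_def)

lemma dim_add_bias [simp]: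
  "dim_row (add_bias A X b) = dim_row X" "dim_col (add_bias A X b) = dim_col X"
  by (simp_all add: add_bias_def)

lemma dim_mlp_apply [simp]:
  "dim_row (mlp_apply A M X) = dim_row X" "dim_col (mlp_apply A M X) = dim_col (W2 M)"
  by (simp_all add: mlp_apply_def)

lemma dim_mhca [simp]:
  "dim_row (mhca A N X Y) = dim_row Y" "dim_col (mhca A N X Y) = dim_col (WO N)"
  by (simp_all add: mhca_def concat_cols_def)

lemma dim_mhsa_masked [simp]:
  "dim_row (mhsa_masked A N X) = dim_row X" "dim_col (mhsa_masked A N X) = dim_col (WO N)"
  by (simp_all add: mhsa_masked_def concat_cols_def)

lemma row_fmat_mult:
  assumes "i < dim_row X" "dim_col X = dim_row W"
  shows "row (fmat_mult A X W) i = row_mult A (row X i) W"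
proof (rule eq_vecI)
  fix j assume "j < dim_vec (row_mult A (row X i) W)"
  then show "row (fmat_mult A X W) i $ j = row_mult A (row X i) W $ j"
    using assms
    by (auto simp: fmat_mult_def row_mult_def intro!: arg_cong[where f = "fsum A"] map_cong)
qed simp

lemma row_fmat_add:
  assumes "i < dim_row X" "dim_row Y = dim_row X" "dim_col Y = dim_col X"
  shows "row (fmat_add A X Y) i = row_add A (row X i) (row Y i)"
  using assms by (intro eq_vecI) (auto simp: fmat_add_def row_add_def)

lemma row_add_bias:
  assumes "i < dim_row X"
  shows "row (add_bias A X b) i = row_add A (row X i) b"
  using assms by (intro eq_vecI) (auto simp: add_bias_def row_add_def)

lemma row_map_mat:
  assumes "i < dim_row X"
  shows "row (map_mat f X) i = map_vec f (row X i)"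
  using assms by (intro eq_vecI) auto

lemma row_mlp_apply:
  assumes "i < dim_row X" "dim_col X = dim_row (W1 M)" "dim_col (W1 M) = dim_row (W2 M)"
  shows "row (mlp_apply A M X) i = row_mlp A M (row X i)"
  using assms by (simp add: mlp_apply_def row_mlp_def row_add_bias row_fmat_mult row_map_mat)

lemma dim_scores [simp]:
  "dim_row (scores A H X Y) = dim_row Y" "dim_col (scores A H X Y) = dim_row X"
  by (simp_all add: scores_def)

lemma index_fmat_mult:
  assumes "i < dim_row X" "j < dim_col Y"
  shows "fmat_mult A X Y $$ (i, j) =
    fsum A (map (\<lambda>k. fmult A (X $$ (i, k)) (Y $$ (k, j))) [0..<dim_row Y])"
  using assms by (simp add: fmat_mult_def)

lemma fmat_mult_eq_row_mult:
  assumes "i < dim_row X" "j < dim_col W" "dim_col X = dim_row W"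
  shows "fmat_mult A X W $$ (i, j) = row_mult A (row X i) W $ j"
  using assms by (simp add: row_fmat_mult[symmetric])

lemma index_scores:
  assumes i: "i < dim_row Y" and j: "j < dim_row X"
    and dims: "dim_col Y = dim_row (WQ H)" "dim_col X = dim_row (WK H)"
      "dim_col (WQ H) = dim_col (WK H)"
  shows "scores A H X Y $$ (i, j) = score A H (row Y i) (row X j)"
proof -
  let ?S = "fmat_mult A (fmat_mult A Y (WQ H)) (transpose_mat (fmat_mult A X (WK H)))"
  have "?S $$ (i, j) = fsum A (map (\<lambda>k. fmult A (fmat_mult A Y (WQ H) $$ (i, k))
      (transpose_mat (fmat_mult A X (WK H)) $$ (k, j))) [0..<dim_col (WK H)])"
    using i j by (subst index_fmat_mult) simp_all
  also have "\<dots> = fsum A (map (\<lambda>k. fmult A (row_mult A (row Y i) (WQ H) $ k)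
      (row_mult A (row X j) (WK H) $ k)) [0..<dim_col (WK H)])"
    using i j dims
    by (intro arg_cong[where f = "fsum A"] map_cong) (auto simp: fmat_mult_eq_row_mult)
  finally show ?thesis using i j by (simp add: scores_def score_def)
qed

lemma list_of_row: "i < dim_row S \<Longrightarrow> list_of_vec (row S i) = map (\<lambda>j. S $$ (i, j)) [0..<dim_col S]"
  by (simp add: row_def)

lemma softmax_conv_weight:
  assumes A: "wf_arith A" and j: "j < dim_vec x"
  shows "softmax A x $ j = softmax_weight A (mset (list_of_vec x)) (x $ j)"
proof -
  have set: "set (list_of_vec x) = {x $ i | i. i < dim_vec x}"
    by (auto simp: list_of_vec_map)
  have all: "(\<forall>i<dim_vec x. x $ i = fminf A) \<longleftrightarrow> set (list_of_vec x) \<subseteq> {fminf A}"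
    unfolding set by blast
  have sum: "fsum A (list_of_vec (map_vec f x)) = fsum_mset A (image_mset f (mset (list_of_vec x)))" for f
  proof -
    have "list_of_vec (map_vec f x) = map f (list_of_vec x)"
      by (simp add: list_of_vec_map)
    then show ?thesis by (simp add: fsum_conv_mset[OF A])
  qed
  show ?thesis
    unfolding softmax_def softmax_weight_def all Let_def fmax_def sum
    using j by simp
qed

lemma index_softmax_rows:
  assumes "wf_arith A" "i < dim_row S" "j < dim_col S"
  shows "softmax_rows A S $$ (i, j) =
    softmax_weight A (image_mset (\<lambda>j. S $$ (i, j)) (mset_set {0..<dim_col S})) (S $$ (i, j))"
  using assms by (simp add: softmax_rows_def softmax_conv_weight list_of_row)

text \<open>The positions of \<open>X\<close> enter only through a maximum and through sums, so
  their order is lost; of \<open>Y\<close> only the querying row is read.\<close>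

lemma row_attention_eq:
  assumes A: "wf_arith A" and i: "i < dim_row Y"
    and dims: "dim_col Y = dim_row (WQ H)" "dim_col X = dim_row (WK H)"
      "dim_col (WQ H) = dim_col (WK H)" "dim_col X = dim_row (WV H)"
  shows "row (attention A H X Y) i = row_attention A {#} H (rows_below X (dim_row X)) (row Y i)"
proof (rule eq_vecI)
  let ?S = "scores A H X Y" and ?n = "dim_row X"
  let ?Z = "image_mset (score A H (row Y i)) (rows_below X ?n)"
  fix c assume "c < dim_vec (row_attention A {#} H (rows_below X ?n) (row Y i))"
  then have c: "c < dim_col (WV H)" by (simp add: row_attention_def)
  have Z: "image_mset (\<lambda>j. ?S $$ (i, j)) (mset_set {0..<?n}) = ?Z"
    using i dims by (auto intro!: image_mset_cong simp: index_scores multiset.map_comp)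
  have "row (attention A H X Y) i $ c = attention A H X Y $$ (i, c)"
    using i c by (simp add: attention_def softmax_rows_def)
  also have "\<dots> = fsum A (map (\<lambda>k. fmult A (softmax_rows A ?S $$ (i, k))
      (fmat_mult A X (WV H) $$ (k, c))) [0..<?n])"
    using i c unfolding attention_def by (subst index_fmat_mult) (simp_all add: softmax_rows_def)
  also have "\<dots> = fsum A (map (\<lambda>k. fmult A (softmax_weight A ?Z (score A H (row Y i) (row X k)))
      (row_mult A (row X k) (WV H) $ c)) [0..<?n])"
    using i c dims Z
    by (intro arg_cong[where f = "fsum A"] map_cong)
      (auto simp: fmat_mult_eq_row_mult index_softmax_rows[OF A] index_scores)
  finally show "row (attention A H X Y) i $ c =
      row_attention A {#} H (rows_below X ?n) (row Y i) $ c"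
    using c by (simp add: row_attention_def fsum_conv_mset[OF A] multiset.map_comp comp_def)
qed (simp add: row_attention_def attention_def)

section \<open>Softmax and attention under the causal mask\<close>

lemma arg_max_on_finite:
  fixes f :: "'a \<Rightarrow> 'b::linorder"
  assumes "finite S" "S \<noteq> {}"
  shows "arg_max_on f S \<in> S" "x \<in> S \<Longrightarrow> f x \<le> f (arg_max_on f S)"
proof -
  have "Max (f ` S) \<in> f ` S" using assms by simp
  then obtain y where y: "y \<in> S" "f y = Max (f ` S)" by auto
  have "is_arg_max f (\<lambda>x. x \<in> S) y"
    using assms y by (auto simp: is_arg_max_def not_less)
  then have "is_arg_max f (\<lambda>x. x \<in> S) (arg_max_on f S)"
    unfolding arg_max_on_def arg_max_def by (rule someI)
  then show "arg_max_on f S \<in> S" "x \<in> S \<Longrightarrow> f x \<le> f (arg_max_on f S)"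
    by (auto simp: is_arg_max_def not_less)
qed

lemma fsum_mset_NaN: "NaN \<in># M \<Longrightarrow> fsum_mset A M = NaN"
  unfolding fsum_mset_def by (rule fsum_NaN) (metis mset_some set_mset_mset)

lemma val_fsum_mset_nonzero:
  assumes "wf_arith A"
  shows "val A (fsum_mset A M) = val A (fsum_mset A (filter_mset (\<lambda>z. val A z \<noteq> Some 0) M))"
  using val_fsum_nonzero[OF assms, of "SOME xs. mset xs = M"]
  by (simp add: fsum_conv_mset[OF assms] mset_some)

lemma val_fsum_mset_replicate_zero:
  assumes "wf_arith A" "val A z = Some 0"
  shows "val A (fsum_mset A (replicate_mset n z + M)) = val A (fsum_mset A M)"
proof -
  have "filter_mset (\<lambda>z. val A z \<noteq> Some 0) (replicate_mset n z + M) =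
      filter_mset (\<lambda>z. val A z \<noteq> Some 0) M"
    using assms(2) by (induction n) auto
  then show ?thesis
    using val_fsum_mset_nonzero[OF assms(1), of "replicate_mset n z + M"]
      val_fsum_mset_nonzero[OF assms(1), of M] by (simp only:)
qed

text \<open>
  The softmax does see the hidden positions, all with score \<open>-\<infinity>\<close>. They contribute zeros to the
  denominator (or \<open>NaN\<close>, if a visible score already is \<open>NaN\<close>), so their number does not matter as
  long as it is positive, which strict masking guarantees.
\<close>

lemma softmax_weight_masked:
  assumes A: "wf_arith A" and n: "n > 0"
  shows "softmax_weight A (replicate_mset n (fminf A) + Z) s =
    softmax_weight A ({#fminf A#} + Z) s"
proof (cases "set_mset Z \<subseteq> {fminf A}")
  case True
  then show ?thesis by (auto simp: softmax_weight_def)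
next
  case False
  let ?Z = "{#fminf A#} + Z"
  define \<beta> where "\<beta> = (if NaN \<in># ?Z then NaN else arg_max_on (fkey A) (set_mset ?Z))"
  let ?f = "\<lambda>y. fexp A (fsub A y \<beta>)"
  have set: "set_mset (replicate_mset n (fminf A) + Z) = set_mset ?Z" using n by auto
  \<comment> \<open>Only the values of the denominators are compared, since extra zeros may change
    the sign bit of a zero sum; the division reads nothing but the value.\<close>
  have "val A (fsum_mset A (image_mset ?f (replicate_mset n (fminf A) + Z))) =
      val A (fsum_mset A (image_mset ?f ?Z))"
  proof (cases "NaN \<in># ?Z")
    case True
    then have "\<beta> = NaN" by (simp add: \<beta>_def)
    \<comment> \<open>A \<open>NaN\<close> maximum turns every exponential into \<open>NaN\<close>,
      hence also each sum with at least one summand.\<close>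
    moreover have "fsub A y NaN = NaN" for y
      by (cases "val A y") (simp_all add: fsub_def lift_op_def fround_def)
    ultimately have "?f y = NaN" for y using A by (simp add: wf_arith_def)
    then have "fsum_mset A (image_mset ?f M) = NaN" if "M \<noteq> {#}" for M
      using that by (intro fsum_mset_NaN) (auto simp: image_iff)
    moreover have "replicate_mset n (fminf A) + Z \<noteq> {#}" using n by (cases n) auto
    moreover have "?Z \<noteq> {#}" by simp
    ultimately show ?thesis by metis
  next
    case no_NaN: False
    then have \<beta>: "\<beta> = arg_max_on (fkey A) (set_mset ?Z)" by (simp add: \<beta>_def)
    have "\<beta> \<in># ?Z" unfolding \<beta> by (rule arg_max_on_finite) simp_all
    then have "\<beta> \<noteq> NaN" using no_NaN by metis
    then obtain v where v: "val A \<beta> = Some v" using val_eq_None_iff by blast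
    \<comment> \<open>A visible score other than -\<infinity> keeps the maximum above -\<infinity>.
      So subtracting the maximum from a hidden score gives -\<infinity> and not \<open>NaN\<close>,
      and its exponential has value 0.\<close>
    obtain t where t: "t \<in># Z" "t \<noteq> fminf A" using False by blast
    then have "t \<noteq> NaN" using no_NaN by auto
    then obtain u where u: "val A t = Some u" using val_eq_None_iff by blast
    then have "u \<noteq> -\<infinity>" using t val_eq_MInfty_iff by auto
    moreover have "fkey A t \<le> fkey A \<beta>"
      unfolding \<beta> using t by (intro arg_max_on_finite) simp_all
    ultimately have "v \<noteq> -\<infinity>" using u v by (auto simp: fkey_def)
    then have "fsub A (fminf A) \<beta> = fminf A"
      using v by (cases v) (simp_all add: fsub_def lift_op_def exact_add_def fround_def)
    then have zero: "val A (?f (fminf A)) = Some 0" using A by (simp add: wf_arith_def)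
    show ?thesis
      using val_fsum_mset_replicate_zero[OF A zero, of n "image_mset ?f Z"]
        val_fsum_mset_replicate_zero[OF A zero, of 1 "image_mset ?f Z"] by simp
  qed
  then have "fdiv A x (fsum_mset A (image_mset ?f (replicate_mset n (fminf A) + Z))) =
      fdiv A x (fsum_mset A (image_mset ?f ?Z))" for x
    by (simp only: fdiv_def lift_op_def)
  then show ?thesis
    unfolding softmax_weight_def set \<beta>_def[symmetric] Let_def by simp
qed

text \<open>The length of the suffix affects the softmax of row \<open>i\<close> only through the
  \<open>dim_row X - i\<close> hidden positions, which include \<open>i\<close> itself. They
  collapse to one extra score and are skipped by the weighted sum, leaving a function of row
  \<open>i\<close> and the rows before it.\<close>

lemma row_masked_attention_eq:
  assumes A: "wf_arith A" and i: "i < dim_row X"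
    and dims: "dim_col X = dim_row (WQ H)" "dim_col X = dim_row (WK H)"
      "dim_col (WQ H) = dim_col (WK H)" "dim_col X = dim_row (WV H)"
  shows "row (masked_attention A H X X) i =
    row_attention A {#fminf A#} H (rows_below X i) (row X i)"
proof (rule eq_vecI)
  let ?S = "causal_mask A (scores A H X X)" and ?n = "dim_row X"
  let ?Z = "image_mset (score A H (row X i)) (rows_below X i)"
  fix c assume "c < dim_vec (row_attention A {#fminf A#} H (rows_below X i) (row X i))"
  then have c: "c < dim_col (WV H)" by (simp add: row_attention_def)
  have mask: "?S $$ (i, j) = (if j \<ge> i then fminf A else score A H (row X i) (row X j))"
    if "j < ?n" for j
    using that i dims by (simp add: causal_mask_def index_scores)
  have dim_S: "dim_row ?S = ?n" "dim_col ?S = ?n" by (simp_all add: causal_mask_def)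
  have "{0..<?n} = {0..<i} \<union> {i..<?n}" using i by auto
  then have "mset_set {0..<?n} = mset_set {i..<?n} + mset_set {0..<i}"
    by (subst mset_set_Union[symmetric]) (auto simp: Un_commute)
  moreover have "image_mset (\<lambda>j. ?S $$ (i, j)) (mset_set {i..<?n}) =
      image_mset (\<lambda>j. fminf A) (mset_set {i..<?n})"
    using mask by (intro image_mset_cong) simp
  moreover have "image_mset (\<lambda>j. ?S $$ (i, j)) (mset_set {0..<i}) = ?Z"
    using mask i by (auto intro!: image_mset_cong simp: multiset.map_comp)
  ultimately have Z: "image_mset (\<lambda>j. ?S $$ (i, j)) (mset_set {0..<?n}) =
      replicate_mset (?n - i) (fminf A) + ?Z"
    by (simp add: image_mset_const_eq)
  have weight: "softmax_rows A ?S $$ (i, k) =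
      softmax_weight A ({#fminf A#} + ?Z) (score A H (row X i) (row X k))" if "k < i" for k
    using that i index_softmax_rows[OF A, of i ?S k] mask[of k]
      softmax_weight_masked[OF A, of "?n - i" ?Z "score A H (row X i) (row X k)"]
    by (simp add: dim_S Z)
  have visible: "filter (\<lambda>k. k < i) [0..<?n] = [0..<i]"
  proof -
    have "[0..<?n] = [0..<i] @ [i..<?n]" using i upt_add_eq_append[of 0 i "?n - i"] by simp
    then show ?thesis by simp
  qed
  have "row (masked_attention A H X X) i $ c = masked_attention A H X X $$ (i, c)"
    using i c by (simp add: masked_attention_def masked_mult_def softmax_rows_def causal_mask_def)
  also have "\<dots> = fsum A (map (\<lambda>k. fmult A (softmax_rows A ?S $$ (i, k))
      (fmat_mult A X (WV H) $$ (k, c))) [0..<i])"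
    using i c unfolding masked_attention_def masked_mult_def
    by (simp add: dim_S visible softmax_rows_def)
  also have "\<dots> = fsum A (map (\<lambda>k. fmult A
      (softmax_weight A ({#fminf A#} + ?Z) (score A H (row X i) (row X k)))
      (row_mult A (row X k) (WV H) $ c)) [0..<i])"
    using i c dims weight
    by (intro arg_cong[where f = "fsum A"] map_cong) (auto simp: fmat_mult_eq_row_mult)
  finally show "row (masked_attention A H X X) i $ c =
      row_attention A {#fminf A#} H (rows_below X i) (row X i) $ c"
    using c by (simp add: row_attention_def fsum_conv_mset[OF A] multiset.map_comp comp_def)
qed (simp add: row_attention_def masked_attention_def masked_mult_def)

section \<open>Rows of multi-head attention and of whole layers\<close>

lemma row_concat_cols:
  assumes "i < n" "\<And>H. H \<in> set Hs \<Longrightarrow> dim_row H = n"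
  shows "row (concat_cols n Hs) i = vec_of_list (concat (map (\<lambda>H. list_of_vec (row H i)) Hs))"
proof (rule eq_vecI)
  show dim: "dim_vec (row (concat_cols n Hs) i) =
      dim_vec (vec_of_list (concat (map (\<lambda>H. list_of_vec (row H i)) Hs)))"
    by (simp add: concat_cols_def length_concat comp_def)
  fix j assume "j < dim_vec (vec_of_list (concat (map (\<lambda>H. list_of_vec (row H i)) Hs)))"
  then show "row (concat_cols n Hs) i $ j =
      vec_of_list (concat (map (\<lambda>H. list_of_vec (row H i)) Hs)) $ j"
    using assms(1) unfolding dim[symmetric] by (simp add: concat_cols_def vec_of_list_index)
qed

lemma wf_multi_headD:
  assumes "wf_multi_head A d dk dv N" "H \<in> set (heads N)"
  shows "dim_row (WQ H) = d" "dim_col (WQ H) = dk" "dim_row (WK H) = d" "dim_col (WK H) = dk"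
    "dim_row (WV H) = d" "dim_col (WV H) = dv"
  using assms by (auto simp: wf_multi_head_def flt_mats_def)

lemma wf_multi_head_WO:
  assumes "wf_multi_head A d dk dv N"
  shows "dim_row (WO N) = length (heads N) * dv" "dim_col (WO N) = d"
  using assms by (auto simp: wf_multi_head_def flt_mats_def)

lemma dim_col_concat_cols:
  assumes "\<And>H. H \<in> set Hs \<Longrightarrow> dim_col (f H) = m"
  shows "dim_col (concat_cols n (map f Hs)) = length Hs * m"
proof -
  have "(\<Sum>H\<leftarrow>Hs. dim_col (f H)) = length Hs * m"
    using assms by (induction Hs) auto
  then show ?thesis by (simp add: concat_cols_def comp_def)
qed

lemma row_mhca:
  assumes A: "wf_arith A" and N: "wf_multi_head A d dk dv N"
    and XY: "dim_col X = d" "dim_col Y = d" and i: "i < dim_row Y"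
  shows "row (mhca A N X Y) i = row_multi_head A {#} N (rows_below X (dim_row X)) (row Y i)"
proof -
  let ?C = "concat_cols (dim_row Y) (map (\<lambda>H. attention A H X Y) (heads N))"
  have "dim_col ?C = length (heads N) * dv"
    using wf_multi_headD[OF N] by (intro dim_col_concat_cols) (simp add: attention_def)
  then have "row (mhca A N X Y) i = row_mult A (row ?C i) (WO N)"
    using i wf_multi_head_WO[OF N] unfolding mhca_def
    by (intro row_fmat_mult) (simp_all add: concat_cols_def)
  also have "row ?C i = vec_of_list (concat (map (\<lambda>H. list_of_vec (row (attention A H X Y) i)) (heads N)))"
    using i by (subst row_concat_cols) (auto simp: attention_def softmax_rows_def comp_def)
  also have "map (\<lambda>H. list_of_vec (row (attention A H X Y) i)) (heads N) =
      map (\<lambda>H. list_of_vec (row_attention A {#} H (rows_below X (dim_row X)) (row Y i))) (heads N)"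
    using wf_multi_headD[OF N] XY i by (intro map_cong) (simp_all add: row_attention_eq[OF A])
  finally show ?thesis by (simp add: row_multi_head_def)
qed

lemma row_mhsa_masked:
  assumes A: "wf_arith A" and N: "wf_multi_head A d dk dv N"
    and X: "dim_col X = d" and i: "i < dim_row X"
  shows "row (mhsa_masked A N X) i = row_multi_head A {#fminf A#} N (rows_below X i) (row X i)"
proof -
  let ?C = "concat_cols (dim_row X) (map (\<lambda>H. masked_attention A H X X) (heads N))"
  have "dim_col ?C = length (heads N) * dv"
    using wf_multi_headD[OF N]
    by (intro dim_col_concat_cols) (simp add: masked_attention_def masked_mult_def)
  then have "row (mhsa_masked A N X) i = row_mult A (row ?C i) (WO N)"
    using i wf_multi_head_WO[OF N] unfolding mhsa_masked_def
    by (intro row_fmat_mult) (simp_all add: concat_cols_def)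
  also have "row ?C i =
      vec_of_list (concat (map (\<lambda>H. list_of_vec (row (masked_attention A H X X) i)) (heads N)))"
    using i by (subst row_concat_cols)
      (auto simp: masked_attention_def masked_mult_def softmax_rows_def causal_mask_def comp_def)
  also have "map (\<lambda>H. list_of_vec (row (masked_attention A H X X) i)) (heads N) =
      map (\<lambda>H. list_of_vec (row_attention A {#fminf A#} H (rows_below X i) (row X i))) (heads N)"
    using wf_multi_headD[OF N] X i by (intro map_cong) (simp_all add: row_masked_attention_eq[OF A])
  finally show ?thesis by (simp add: row_multi_head_def)
qed

lemma wf_mlpD:
  assumes "wf_mlp A d dff M"
  shows "dim_row (W1 M) = d" "dim_col (W1 M) = dff" "dim_row (W2 M) = dff" "dim_col (W2 M) = d"
  using assms by (auto simp: wf_mlp_def flt_mats_def)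

lemma row_enc_apply:
  assumes A: "wf_arith A" and L: "wf_multi_head A d dk dv (enc_self L)" "wf_mlp A d dff (enc_mlp L)"
    and X: "X \<in> carrier_mat n d"
  shows "enc_apply A L X \<in> carrier_mat n d"
    and "i < n \<Longrightarrow> row (enc_apply A L X) i = row_enc A L (rows_below X n) (row X i)"
proof -
  note dims = wf_mlpD[OF L(2)] wf_multi_head_WO[OF L(1)] carrier_matD[OF X]
  show "enc_apply A L X \<in> carrier_mat n d"
    using dims by (intro carrier_matI) (simp_all add: enc_apply_def Let_def mhsa_def)
  assume "i < n"
  then show "row (enc_apply A L X) i = row_enc A L (rows_below X n) (row X i)"
    using dims
    by (simp add: enc_apply_def row_enc_def Let_def mhsa_def row_fmat_add row_mlp_apply
        row_mhca[OF A L(1)])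
qed

lemma row_dec_apply:
  assumes A: "wf_arith A"
    and L: "wf_multi_head A d dk dv (dec_self L)" "wf_multi_head A d dk dv (dec_cross L)"
      "wf_mlp A d dff (dec_mlp L)"
    and X: "X \<in> carrier_mat m d" and Y: "Y \<in> carrier_mat n d"
  shows "dec_apply A L X Y \<in> carrier_mat n d"
    and "i < n \<Longrightarrow>
      row (dec_apply A L X Y) i = row_dec A L (rows_below X m) (rows_below Y i) (row Y i)"
proof -
  note dims = wf_mlpD[OF L(3)] wf_multi_head_WO[OF L(1)] wf_multi_head_WO[OF L(2)]
    carrier_matD[OF X] carrier_matD[OF Y]
  show "dec_apply A L X Y \<in> carrier_mat n d"
    using dims by (intro carrier_matI) (simp_all add: dec_apply_def Let_def)
  assume "i < n"
  then show "row (dec_apply A L X Y) i = row_dec A L (rows_below X m) (rows_below Y i) (row Y i)"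
    using dims
    by (simp add: dec_apply_def row_dec_def Let_def row_fmat_add row_mlp_apply
        row_mhca[OF A L(2)] row_mhsa_masked[OF A L(1)])
qed

section \<open>Output row, its bit length, and finiteness of the state components\<close>

definition row_out :: "fp_arith \<Rightarrow> 's transformer \<Rightarrow> flt vec \<Rightarrow> flt vec" where
  "row_out A T y = row_add A (row_mult A y (Wout T)) (bout T)"

lemma row_out_head:
  assumes "i < dim_row Y" "dim_col Y = dim_row (Wout T)"
  shows "row (out_head A T Y) i = row_out A T (row Y i)"
  using assms by (simp add: out_head_def row_out_def row_add_bias row_fmat_mult)

lemma length_bitwise:
  assumes A: "wf_arith A" and y: "y \<in> flt_vecs A n"
  shows "length (bitwise A y) = n * (expw A + prec A + 1)"
proof -
  have "length (flt_bits A f) = expw A + prec A + 1" if "f \<in> floats A" for f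
    using that A length_format by (cases f) (auto simp: wf_arith_def)
  then have "length (concat (map (flt_bits A) xs)) = length xs * (expw A + prec A + 1)"
    if "set xs \<subseteq> floats A" for xs
    using that by (induction xs) auto
  moreover have "set (list_of_vec y) \<subseteq> floats A" "length (list_of_vec y) = n"
    using y by (auto simp: flt_vecs_def list_of_vec_map)
  ultimately show ?thesis unfolding bitwise_def by metis
qed

lemma finite_flt_vecs: "finite (flt_vecs A n)"
proof -
  have "list_of_vec ` flt_vecs A n \<subseteq> {xs. set xs \<subseteq> floats A \<and> length xs = n}"
    by (auto simp: flt_vecs_def list_of_vec_map)
  then have "finite (list_of_vec ` flt_vecs A n)"
    using finite_lists_length_eq[OF finite_format] by (rule finite_subset)
  then show ?thesis
    by (rule finite_imageD) (metis inj_onI vec_list)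
qed

section \<open>Automata with abstract states\<close>

text \<open>The counterpart of \<open>cpg_state\<close> with states of any type and uncapped
  multisets, so that the simulation can be described without bit strings.\<close>

primrec run :: "('s option \<Rightarrow> 'q) \<Rightarrow> ('q \<Rightarrow> 'q multiset \<Rightarrow> 'q multiset \<Rightarrow> 'q) \<Rightarrow>
    's tsgraph \<Rightarrow> nat \<Rightarrow> nat \<Rightarrow> 'q" where
  "run ini \<delta> G 0 = (\<lambda>v. ini (lab G v))"
| "run ini \<delta> G (Suc t) = (\<lambda>v. \<delta> (run ini \<delta> G t v)
     (image_mset (run ini \<delta> G t) (mset_set {u \<in> verts G. u < bos G}))
     (image_mset (run ini \<delta> G t) (mset_set {u \<in> verts G. bos G \<le> u \<and> u < v})))"

text \<open>A unary code suffices: the number of ones identifies the element, and padding with zeros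
  equalises the lengths, as all states of an automaton must be equally long.\<close>

lemma exists_fixed_length_code:
  assumes "finite S"
  shows "\<exists>c :: 'a \<Rightarrow> bool list. inj_on c S \<and> (\<forall>x\<in>S. length (c x) = card S)"
proof -
  obtain h where h: "bij_betw h S {0..<card S}"
    using ex_bij_betw_finite_nat[OF assms] by blast
  define c where "c x = replicate (h x) True @ replicate (card S - h x) False" for x
  have "length (filter (\<lambda>b. b) (c x)) = h x" for x
    by (simp add: c_def filter_replicate)
  then have "inj_on c S" using h by (metis bij_betw_imp_inj_on inj_on_def)
  moreover have "length (c x) = card S" if "x \<in> S" for x
    using bij_betwE[OF h] that by (fastforce simp: c_def)
  ultimately show ?thesis by blast
qed

text \<open>The automaton receives capped multisets of bit strings. Once decoded they are
  \<open>cap_eq\<close> to the true multisets of abstract states, and by \<open>capped\<close> this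
  is all that \<open>\<delta>\<close> distinguishes.\<close>

lemma cpg_automaton_of_finite_states:
  fixes ini :: "'s option \<Rightarrow> 'q"
  assumes fin: "finite S" and ini: "ini ` tokens \<Sigma> \<subseteq> S"
    and closed: "\<And>x M N. x \<in> S \<Longrightarrow> set_mset M \<subseteq> S \<Longrightarrow> set_mset N \<subseteq> S \<Longrightarrow> \<delta> x M N \<in> S"
    and capped: "\<And>x M M' N N'. cap_eq k M M' \<Longrightarrow> cap_eq k N N' \<Longrightarrow> \<delta> x M N = \<delta> x M' N'"
    and out: "\<And>x. x \<in> S \<Longrightarrow> length (out x) = b" and b: "b > 0"
  shows "\<exists>C :: 's cpg. cpg_automaton \<Sigma> C \<and> (\<forall>G. two_sorted_graph \<Sigma> G \<longrightarrow>
    (\<forall>v \<in> verts G. cpg_output C G v = out (run ini \<delta> G n v)))"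
proof -
  obtain c :: "'q \<Rightarrow> bool list" where c: "inj_on c S" "\<And>x. x \<in> S \<Longrightarrow> length (c x) = card S"
    using exists_fixed_length_code[OF fin] by blast
  \<comment> \<open>The leading \<open>out x\<close> makes the output a prefix of the state; the
    code behind it restores injectivity, as \<open>out\<close> may identify different
    states.\<close>
  define enc where "enc x = out x @ c x" for x
  have "inj_on enc S"
    using c(1) out by (auto simp: enc_def inj_on_def)
  define dec where "dec = inv_into S enc"
  have dec [simp]: "dec (enc x) = x" if "x \<in> S" for x
    unfolding dec_def using \<open>inj_on enc S\<close> that by (rule inv_into_f_f)
  define C :: "'s cpg" where "C = \<lparr>states = enc ` S, init = (\<lambda>a. enc (ini a)), cap = k,
    trans = (\<lambda>x M N. enc (\<delta> (dec x) (image_mset dec M) (image_mset dec N))),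
    out_round = n, out_length = b\<rparr>"
  have "states C \<subseteq> {x. length x = b + card S}"
    using out c(2) by (auto simp: C_def enc_def)
  moreover have "S \<noteq> {}" using ini by (auto simp: tokens_def)
  moreover have "trans C x M N \<in> states C"
    if "x \<in> states C" "M \<in> capped_msets (cap C) (states C)" "N \<in> capped_msets (cap C) (states C)"
    for x M N
  proof -
    have "dec x \<in> S" "set_mset (image_mset dec M) \<subseteq> S" "set_mset (image_mset dec N) \<subseteq> S"
      using that by (auto simp: C_def capped_msets_def)
    then show ?thesis using closed by (simp add: C_def)
  qed
  ultimately have "cpg_automaton \<Sigma> C"
    using fin ini b unfolding cpg_automaton_def
    by (intro conjI exI[of _ "b + card S"] ballI) (auto simp: C_def)
  moreover have "cpg_output C G v = out (run ini \<delta> G n v)"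
    if G: "two_sorted_graph \<Sigma> G" and v: "v \<in> verts G" for G v
  proof -
    have fin_verts: "finite (verts G)"
      using G unfolding two_sorted_graph_def by (metis finite_atLeastAtMost)
    have labels: "lab G ` verts G \<subseteq> tokens \<Sigma>"
      using G unfolding two_sorted_graph_def by (elim conjE)
    \<comment> \<open>Decoding inverts encoding on \<open>S\<close> only, so the run must be known
      to stay in \<open>S\<close>.\<close>
    have run_S: "run ini \<delta> G t u \<in> S" if "u \<in> verts G" for t u
      using that
    proof (induction t arbitrary: u)
      case 0
      then show ?case using ini labels by auto
    next
      case (Suc t)
      then show ?case using fin_verts by (auto intro!: closed)
    qed
    have state: "cpg_state C G t u = enc (run ini \<delta> G t u)" if "u \<in> verts G" for t u
      using that
    proof (induction t arbitrary: u)
      case 0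
      show ?case by (simp add: C_def)
    next
      case (Suc t)
      have cap_eq: "cap_eq k (image_mset dec (cap_mset k (image_mset (cpg_state C G t) (mset_set U))))
          (image_mset (run ini \<delta> G t) (mset_set U))" if "U \<subseteq> verts G" for U
      proof -
        have "image_mset dec (image_mset (cpg_state C G t) (mset_set U)) =
            image_mset (run ini \<delta> G t) (mset_set U)"
          unfolding multiset.map_comp
          using that Suc.IH run_S finite_subset[OF that fin_verts]
          by (intro image_mset_cong) (auto simp: subset_iff)
        then show ?thesis using cap_eq_image_mset[OF cap_eq_cap_mset] by metis
      qed
      have "\<delta> (run ini \<delta> G t u)
          (image_mset dec (cap_mset k (image_mset (cpg_state C G t)
            (mset_set {u \<in> verts G. u < bos G}))))
          (image_mset dec (cap_mset k (image_mset (cpg_state C G t)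
            (mset_set {w \<in> verts G. bos G \<le> w \<and> w < u})))) = run ini \<delta> G (Suc t) u"
        unfolding run.simps by (intro capped cap_eq) auto
      then show ?case using Suc run_S by (simp add: C_def)
    qed
    show ?thesis
      using state[OF v] out[OF run_S[OF v]] by (simp add: cpg_output_def C_def enc_def)
  qed
  ultimately show ?thesis by blast
qed

section \<open>Simulation of a transformer\<close>

text \<open>
  A state consists of the round number, an encoder row and a decoder row. Every vertex runs both
  computations; only the encoder rows of the prefix and the decoder rows of the suffix are meaningful.
\<close>

type_synonym sim_state = "nat \<times> flt vec \<times> flt vec"

definition sim_init :: "'s transformer \<Rightarrow> 's option \<Rightarrow> sim_state" where
  "sim_init T a = (0, embed T a, embed T a)"

text \<open>The counter selects the layer. The decoder row waits during the encoder phase;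
  afterwards the encoder row is frozen, because every cross-attention reads the final encoder rows.
  The last branch stops the counter, which keeps the state set finite.\<close>

definition sim_step :: "fp_arith \<Rightarrow> 's transformer \<Rightarrow>
    sim_state \<Rightarrow> sim_state multiset \<Rightarrow> sim_state multiset \<Rightarrow> sim_state" where
  "sim_step A T = (\<lambda>(t, x, y) M N.
     let m = length (enc_layers T); P = image_mset (fst \<circ> snd) M in
     if t < m then (Suc t, row_enc A (enc_layers T ! t) P x, y)
     else if t < m + length (dec_layers T) then
       (Suc t, x, row_dec A (dec_layers T ! (t - m)) P (image_mset (snd \<circ> snd) N) y)
     else (t, x, y))"

lemma sim_step_cap_eq:
  assumes "wf_arith A" "cap_eq (sat_bound A) M M'" "cap_eq (sat_bound A) N N'"
  shows "sim_step A T s M N = sim_step A T s M' N'"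
  using row_enc_cap_eq[OF assms(1) cap_eq_image_mset[OF assms(2)]]
    row_dec_cap_eq[OF assms(1) cap_eq_image_mset[OF assms(2)] cap_eq_image_mset[OF assms(3)]]
  by (simp add: sim_step_def Let_def split: prod.split)

lemma two_sorted_graph_verts:
  assumes "two_sorted_graph \<Sigma> G"
  obtains n where "verts G = {1..n}" "1 \<le> bos G" "bos G \<le> n"
proof -
  obtain n where n: "verts G = {1..n}" using assms unfolding two_sorted_graph_def by blast
  have "\<exists>!w. w \<in> verts G \<and> lab G w = None"
    using assms unfolding two_sorted_graph_def by (elim conjE)
  from theI'[OF this] have "bos G \<in> verts G" by (simp add: bos_def)
  then show ?thesis using n that by auto
qed

lemma embed_verts_interval:
  assumes "dim_vec (embed T None) = d"
    and "\<And>v. a \<le> v \<Longrightarrow> v < b \<Longrightarrow> embed T (lab G v) \<in> carrier_vec d"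
  shows "embed_verts T G {a..<b} \<in> carrier_mat (b - a) d"
    and "a \<le> v \<Longrightarrow> v < b \<Longrightarrow> row (embed_verts T G {a..<b}) (v - a) = embed T (lab G v)"
proof -
  show "embed_verts T G {a..<b} \<in> carrier_mat (b - a) d"
    using assms(1) by (intro carrier_matI) (simp_all add: embed_verts_def)
  assume v: "a \<le> v" "v < b"
  then show "row (embed_verts T G {a..<b}) (v - a) = embed T (lab G v)"
    using assms v unfolding embed_verts_def by (subst mat_of_rows_row) auto
qed

text \<open>Vertices are numbered through the whole graph, rows from 0 in each half, hence the shift
  by \<open>a\<close>. For \<open>b \<le> a\<close> both sides are empty; this covers a prefix
  vertex in the decoder phase, which has no suffix vertex before it.\<close>

lemma image_mset_rows_below:
  assumes "\<And>u. a \<le> u \<Longrightarrow> u < b \<Longrightarrow> f u = row X (u - a)"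
  shows "image_mset f (mset_set {a..<b}) = rows_below X (b - a)"
proof -
  have "{a..<b} = (\<lambda>i. i + a) ` {0..<b - a}"
    by (cases "a \<le> b") (auto simp: image_add_atLeastLessThan')
  then have "mset_set {a..<b} = image_mset (\<lambda>i. i + a) (mset_set {0..<b - a})"
    by (simp only: image_mset_mset_set[OF inj_on_subset[OF inj_on_add' subset_UNIV]])
  moreover have "image_mset (f \<circ> (\<lambda>i. i + a)) (mset_set {0..<b - a}) = rows_below X (b - a)"
    using assms by (intro image_mset_cong) auto
  ultimately show ?thesis by (simp add: multiset.map_comp)
qed

theorem theorem2:
  fixes A :: fp_arith and \<Sigma> :: "'s set" and T :: "'s transformer"
    and d dk dv dff dout :: nat
  assumes "wf_arith A"
    and "wf_transformer A \<Sigma> (d, dk, dv, dff, dout) T"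
  shows "\<exists>C :: 's cpg. cpg_automaton \<Sigma> C \<and>
    (\<forall>G. two_sorted_graph \<Sigma> G \<longrightarrow>
      (\<forall>v \<in> suffix_verts G. cpg_output C G v = bitwise A (transformer_output A T G v)))"
proof -
  note A = assms(1)
  let ?Es = "enc_layers T" and ?Ds = "dec_layers T"
  let ?m = "length ?Es" and ?n = "length ?Ds"
  have dout: "dout > 0" and emb: "\<And>a. a \<in> tokens \<Sigma> \<Longrightarrow> embed T a \<in> flt_vecs A d"
    and encs: "\<And>L. L \<in> set ?Es \<Longrightarrow> wf_multi_head A d dk dv (enc_self L)"
      "\<And>L. L \<in> set ?Es \<Longrightarrow> wf_mlp A d dff (enc_mlp L)"
    and decs: "\<And>L. L \<in> set ?Ds \<Longrightarrow> wf_multi_head A d dk dv (dec_self L)"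
      "\<And>L. L \<in> set ?Ds \<Longrightarrow> wf_multi_head A d dk dv (dec_cross L)"
      "\<And>L. L \<in> set ?Ds \<Longrightarrow> wf_mlp A d dff (dec_mlp L)"
    and Wout: "Wout T \<in> carrier_mat d dout"
    using assms(2) unfolding wf_transformer_def flt_mats_def by auto
  define S where "S = {..?m + ?n} \<times> flt_vecs A d \<times> flt_vecs A d"
  let ?run = "run (sim_init T) (sim_step A T)"
  let ?out = "\<lambda>(t, x, y). bitwise A (row_out A T y)"
  have "\<exists>C :: 's cpg. cpg_automaton \<Sigma> C \<and> (\<forall>G. two_sorted_graph \<Sigma> G \<longrightarrow>
    (\<forall>v \<in> verts G. cpg_output C G v = ?out (?run G (?m + ?n) v)))"
  proof (rule cpg_automaton_of_finite_states)
    show "finite S" by (simp add: S_def finite_flt_vecs)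
    show "sim_init T ` tokens \<Sigma> \<subseteq> S" using emb by (auto simp: S_def sim_init_def)
    show "sim_step A T s M N \<in> S" if "s \<in> S" for s M N
    proof -
      obtain t x y where s: "s = (t, x, y)" by (cases s)
      have st: "t \<le> ?m + ?n" "x \<in> flt_vecs A d" "y \<in> flt_vecs A d"
        using that by (simp_all add: s S_def)
      have "row_enc A (?Es ! t) P x \<in> flt_vecs A d" if "t < ?m" for P
        using row_enc_in_flt_vecs[OF A, of "?Es ! t" P x] wf_mlpD(4)[OF encs(2)[OF nth_mem[OF that]]]
        by simp
      moreover have "row_dec A (?Ds ! (t - ?m)) P Q y \<in> flt_vecs A d"
        if "\<not> t < ?m" "t < ?m + ?n" for P Q
      proof -
        have "t - ?m < ?n" using that by simp
        from wf_mlpD(4)[OF decs(3)[OF nth_mem[OF this]]] show ?thesis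
          using row_dec_in_flt_vecs[OF A, of "?Ds ! (t - ?m)" P Q y] by simp
      qed
      ultimately show ?thesis using st by (auto simp: s sim_step_def S_def Let_def)
    qed
    show "sim_step A T s M N = sim_step A T s M' N'"
      if "cap_eq (sat_bound A) M M'" "cap_eq (sat_bound A) N N'" for s M M' N N'
      by (rule sim_step_cap_eq[OF A that])
    show "length (?out s) = dout * (expw A + prec A + 1)" for s
    proof -
      have "row_out A T y \<in> flt_vecs A dout" for y
        using row_add_in_flt_vecs[OF A, of "row_mult A y (Wout T)"] carrier_matD(2)[OF Wout]
        by (simp add: row_out_def)
      then show ?thesis using length_bitwise[OF A] by (cases s) simp
    qed
    show "dout * (expw A + prec A + 1) > 0" using dout by simp
  qed
  then obtain C :: "'s cpg" where C: "cpg_automaton \<Sigma> C"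
    "\<And>G v. two_sorted_graph \<Sigma> G \<Longrightarrow> v \<in> verts G \<Longrightarrow>
      cpg_output C G v = ?out (?run G (?m + ?n) v)" by blast
  have "cpg_output C G v = bitwise A (transformer_output A T G v)"
    if G: "two_sorted_graph \<Sigma> G" and v: "v \<in> suffix_verts G" for G v
  proof -
    obtain k where k: "verts G = {1..k}" "1 \<le> bos G" "bos G \<le> k"
      using two_sorted_graph_verts[OF G] by blast
    define w where "w = bos G"
    have pre: "prefix_verts G = {1..<w}" and suf: "suffix_verts G = {w..<Suc k}"
      using k by (auto simp: prefix_verts_def suffix_verts_def w_def)
    have below: "{u \<in> verts G. u < bos G} = {1..<w}"
      and between: "{u \<in> verts G. bos G \<le> u \<and> u < v} = {w..<v}" if "v \<in> verts G" for v
      using k that by (auto simp: w_def)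
    have "embed T (lab G u) \<in> carrier_vec d" if "u \<in> verts G" for u
    proof -
      have "lab G u \<in> tokens \<Sigma>" using G that unfolding two_sorted_graph_def by blast
      then show ?thesis using emb by (auto simp: flt_vecs_def)
    qed
    moreover have emb_dim: "dim_vec (embed T None) = d"
      using emb[of None] by (auto simp: tokens_def flt_vecs_def)
    ultimately have emb_pre: "embed_verts T G {1..<w} \<in> carrier_mat (w - 1) d"
        "\<And>u. 1 \<le> u \<Longrightarrow> u < w \<Longrightarrow> row (embed_verts T G {1..<w}) (u - 1) = embed T (lab G u)"
      and emb_suf: "embed_verts T G {w..<Suc k} \<in> carrier_mat (Suc k - w) d"
        "\<And>u. w \<le> u \<Longrightarrow> u < Suc k \<Longrightarrow> row (embed_verts T G {w..<Suc k}) (u - w) = embed T (lab G u)"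
      using k w_def by (auto intro!: embed_verts_interval)
    define X where "X t = fold (enc_apply A) (take t ?Es) (embed_verts T G {1..<w})" for t
    define Y where
      "Y t = fold (\<lambda>L. dec_apply A L (X ?m)) (take t ?Ds) (embed_verts T G {w..<Suc k})" for t
    have X_Suc: "X (Suc t) = enc_apply A (?Es ! t) (X t)" if "t < ?m" for t
      using that by (simp add: X_def take_Suc_conv_app_nth)
    have Y_Suc: "Y (Suc t) = dec_apply A (?Ds ! t) (X ?m) (Y t)" if "t < ?n" for t
      using that by (simp add: Y_def take_Suc_conv_app_nth)
    have X_carrier: "X t \<in> carrier_mat (w - 1) d" if "t \<le> ?m" for t
      using that
    proof (induction t)
      case 0
      then show ?case using emb_pre by (simp add: X_def)
    next
      case (Suc t)
      then have t: "t < ?m" and X: "X t \<in> carrier_mat (w - 1) d" by simp_all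
      show ?case
        unfolding X_Suc[OF t]
        by (rule row_enc_apply(1)[OF A encs[OF nth_mem[OF t]] X])
    qed
    have Y_carrier: "Y t \<in> carrier_mat (Suc k - w) d" if "t \<le> ?n" for t
      using that
    proof (induction t)
      case 0
      then show ?case using emb_suf by (simp add: Y_def)
    next
      case (Suc t)
      then have t: "t < ?n" and Y: "Y t \<in> carrier_mat (Suc k - w) d" by simp_all
      show ?case
        unfolding Y_Suc[OF t]
        by (rule row_dec_apply(1)[OF A decs[OF nth_mem[OF t]] X_carrier[OF order.refl] Y])
    qed
    \<comment> \<open>Row 0 of \<open>X t\<close> belongs to vertex 1, hence \<open>u - 1\<close>.
      The untouched embedding in the last component is what the decoder phase starts from.\<close>
    have enc_phase: "fst (?run G t u) = t \<and> snd (snd (?run G t u)) = embed T (lab G u) \<and>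
        (u < w \<longrightarrow> fst (snd (?run G t u)) = row (X t) (u - 1))"
      if "t \<le> ?m" "u \<in> verts G" for t u
      using that
    proof (induction t arbitrary: u)
      case 0
      then show ?case using emb_pre(2) k by (auto simp: sim_init_def X_def)
    next
      case (Suc t)
      let ?P = "image_mset (fst \<circ> snd) (image_mset (?run G t) (mset_set {1..<w}))"
      have P: "?P = rows_below (X t) (w - 1)"
        unfolding multiset.map_comp using Suc k by (intro image_mset_rows_below) (auto simp: w_def)
      obtain x where run: "?run G t u = (t, x, embed T (lab G u))" "u < w \<Longrightarrow> x = row (X t) (u - 1)"
        using Suc.IH[OF _ Suc.prems(2)] Suc.prems(1) by (cases "?run G t u") auto
      have "?run G (Suc t) u =
          (Suc t, row_enc A (?Es ! t) (rows_below (X t) (w - 1)) x, embed T (lab G u))"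
        using Suc.prems P run(1) by (simp add: sim_step_def below)
      moreover have "row (X (Suc t)) (u - 1) = row_enc A (?Es ! t) (rows_below (X t) (w - 1)) x"
        if "u < w"
      proof -
        have t: "t < ?m" "t \<le> ?m" using Suc.prems by simp_all
        have "u - 1 < w - 1" using that Suc.prems k by auto
        then show ?thesis
          unfolding X_Suc[OF t(1)] run(2)[OF that]
          by (rule row_enc_apply(2)[OF A encs[OF nth_mem[OF t(1)]] X_carrier[OF t(2)]])
      qed
      ultimately show ?case by simp
    qed
    \<comment> \<open>The encoder component is part of the invariant because the multiset for
      cross-attention is rebuilt from it in every round.\<close>
    have dec_phase: "fst (?run G (?m + t) u) = ?m + t \<and>
        (u < w \<longrightarrow> fst (snd (?run G (?m + t) u)) = row (X ?m) (u - 1)) \<and>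
        (w \<le> u \<longrightarrow> snd (snd (?run G (?m + t) u)) = row (Y t) (u - w))"
      if "t \<le> ?n" "u \<in> verts G" for t u
      using that
    proof (induction t arbitrary: u)
      case 0
      then show ?case using enc_phase[of ?m u] emb_suf(2) k by (auto simp: Y_def)
    next
      case (Suc t)
      let ?P = "image_mset (fst \<circ> snd) (image_mset (?run G (?m + t)) (mset_set {1..<w}))"
      let ?Q = "image_mset (snd \<circ> snd) (image_mset (?run G (?m + t)) (mset_set {w..<u}))"
      have P: "?P = rows_below (X ?m) (w - 1)"
        unfolding multiset.map_comp using Suc k by (intro image_mset_rows_below) (auto simp: w_def)
      have Q: "?Q = rows_below (Y t) (u - w)"
        unfolding multiset.map_comp using Suc k by (intro image_mset_rows_below) (auto simp: w_def)
      obtain x y where run: "?run G (?m + t) u = (?m + t, x, y)"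
        "u < w \<Longrightarrow> x = row (X ?m) (u - 1)" "w \<le> u \<Longrightarrow> y = row (Y t) (u - w)"
        using Suc.IH[OF _ Suc.prems(2)] Suc.prems(1) by (cases "?run G (?m + t) u") auto
      have "?run G (?m + Suc t) u = (?m + Suc t, x,
          row_dec A (?Ds ! t) (rows_below (X ?m) (w - 1)) (rows_below (Y t) (u - w)) y)"
        using Suc.prems P Q run(1) by (simp add: sim_step_def below between)
      moreover have "row (Y (Suc t)) (u - w) =
          row_dec A (?Ds ! t) (rows_below (X ?m) (w - 1)) (rows_below (Y t) (u - w)) y" if "w \<le> u"
      proof -
        have t: "t < ?n" "t \<le> ?n" using Suc.prems by simp_all
        have "u - w < Suc k - w" using that Suc.prems k by auto
        then show ?thesis
          unfolding Y_Suc[OF t(1)] run(3)[OF that]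
          by (rule row_dec_apply(2)[OF A decs[OF nth_mem[OF t(1)]] X_carrier[OF order.refl]
                Y_carrier[OF t(2)]])
      qed
      ultimately show ?case using run(2) by (simp del: run.simps)
    qed
    have vw: "w \<le> v" "v < Suc k" "v \<in> verts G" using v suf by (auto simp: suffix_verts_def)
    have "transformer_output A T G v = row (out_head A T (Y ?n)) (v - w)"
      by (simp add: transformer_output_def transformer_apply_def pre suf encoder_def decoder_def
          X_def Y_def w_def)
    also have "\<dots> = row_out A T (row (Y ?n) (v - w))"
      using vw carrier_matD[OF Y_carrier[of ?n]] carrier_matD(1)[OF Wout]
      by (intro row_out_head) auto
    finally show ?thesis
      using C(2)[OF G vw(3)] dec_phase[OF order.refl vw(3)] vw by (simp add: split_beta)
  qed
  then show ?thesis using C(1) by blast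
qed

end
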